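(* Let $\Pi=\mathbb{R}/\mathbb{Z}$ be the circle. Let $a\in C^2(\Pi)$ with $a>0$, $b\in C^1(\Pi)$ and $c\in C^0(\Pi)$. Assume that $b$ changes sign on $\Pi$ (it takes both positive and negative values), that $b$ vanishes at only finitely many points $x_1,\dots,x_n$, and that each zero $x_i$ of $b$ is either of finite order $m_i\ge1$ or flat. For $\epsilon>0$ let $u_\epsilon>0$ be a principal eigenfunction of $L_\epsilon u=\epsilon\,a\,u''+b\,u'+c\,u$ on $\Pi$, and let $W_\epsilon:=-\epsilon\ln u_\epsilon$. Suppose that the maximum $$\max_{x:\,b(x)=0}\bigl(-\max(0,b'(x))+c(x)\bigr)$$ is attained at only one point $x_0$. Then, up to adding constants, $W_\epsilon$ converges uniformly on $\Pi$ as $\epsilon\to0$ to $W(x)=d_H(x,x_0)$; that is, there are constants $C_\epsilon\in\mathbb{R}$ such that $W_\epsilon+C_\epsilon\to d_H(\cdot,x_0)$ uniformly on $\Pi$.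
   Context: A zero $x_i$ of $b$ is of finite order $m_i\ge1$ if $b$ is $C^{m_i}$ in a neighborhood of $x_i$, $b(x_i)=\dots=b^{(m_i-1)}(x_i)=0$ and $b^{(m_i)}(x_i)\ne0$. It is flat if $b$ is $C^\infty$ in a neighborhood of $x_i$ and $b^{(k)}(x_i)=0$ for all $k\in\mathbb{N}$. A principal eigenfunction is an eigenfunction for the principal eigenvalue (the eigenvalue with maximal real part); it is unique up to scaling and can be chosen positive. With $L(v,z):=\dfrac{(v+b(z))^2}{4a(z)}$, the Mañé potential is, for $z,x\in\Pi$, $$d_H(z,x):=\inf_{t>0,\ \eta\in S_z^x(t)}\int_0^t L(-\eta'(s),\eta(s))\,ds,$$ where $S_z^x(t)$ is the set of piecewise $C^1$ curves $\eta:[0,t]\to\Pi$ with $\eta(0)=z$ and $\eta(t)=x$. *)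

theory Defs
  imports "HOL-Analysis.Analysis" "HOL-Library.Periodic_Fun"
begin

text \<open>
  A point of the circle \<open>\<real>/\<int>\<close> is represented by any of its representatives in the reals,
  so two reals denote the same point iff their difference lies in \<open>\<int>\<close>, and a function on the
  circle is a 1-periodic function on the reals (\<open>periodic_fun_simple'\<close>).
\<close>

text \<open>Intended for open \<open>S\<close> only, as the derivatives are two-sided.\<close>

definition Ck_on :: "nat \<Rightarrow> (real \<Rightarrow> real) \<Rightarrow> real set \<Rightarrow> bool" where
  "Ck_on k f S \<longleftrightarrow>
     (\<forall>j<k. \<forall>x\<in>S. (deriv ^^ j) f differentiable (at x)) \<and> continuous_on S ((deriv ^^ k) f)"

definition Ck_circle :: "nat \<Rightarrow> (real \<Rightarrow> real) \<Rightarrow> bool" where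
  "Ck_circle k f \<longleftrightarrow> periodic_fun_simple' f \<and> Ck_on k f UNIV"

definition zero_of_order :: "(real \<Rightarrow> real) \<Rightarrow> real \<Rightarrow> nat \<Rightarrow> bool" where
  "zero_of_order b x m \<longleftrightarrow>
     (\<exists>S. open S \<and> x \<in> S \<and> Ck_on m b S) \<and>
     (\<forall>k<m. (deriv ^^ k) b x = 0) \<and> (deriv ^^ m) b x \<noteq> 0"

definition flat_zero :: "(real \<Rightarrow> real) \<Rightarrow> real \<Rightarrow> bool" where
  "flat_zero b x \<longleftrightarrow>
     (\<exists>S. open S \<and> x \<in> S \<and> (\<forall>k. Ck_on k b S)) \<and> (\<forall>k. (deriv ^^ k) b x = 0)"

text \<open>
  Eigenvalues and eigenfunctions are complex, since the operator is not self-adjoint and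
  the principal eigenvalue is singled out among all complex ones.
\<close>

definition eigenpair ::
  "(real \<Rightarrow> real) \<Rightarrow> (real \<Rightarrow> real) \<Rightarrow> (real \<Rightarrow> real) \<Rightarrow> real \<Rightarrow> complex \<Rightarrow> (real \<Rightarrow> complex) \<Rightarrow> bool" where
  "eigenpair a b c \<epsilon> \<mu> \<phi> \<longleftrightarrow>
     periodic_fun_simple' \<phi> \<and> (\<exists>x. \<phi> x \<noteq> 0) \<and>
     (\<exists>\<phi>' \<phi>''.
        (\<forall>x. (\<phi> has_vector_derivative \<phi>' x) (at x)) \<and>
        (\<forall>x. (\<phi>' has_vector_derivative \<phi>'' x) (at x)) \<and>
        continuous_on UNIV \<phi>'' \<and>
        (\<forall>x. of_real (\<epsilon> * a x) * \<phi>'' x + of_real (b x) * \<phi>' x + of_real (c x) * \<phi> x = \<mu> * \<phi> x))"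

definition principal_eigenvalue ::
  "(real \<Rightarrow> real) \<Rightarrow> (real \<Rightarrow> real) \<Rightarrow> (real \<Rightarrow> real) \<Rightarrow> real \<Rightarrow> complex \<Rightarrow> bool" where
  "principal_eigenvalue a b c \<epsilon> \<mu> \<longleftrightarrow>
     (\<exists>\<phi>. eigenpair a b c \<epsilon> \<mu> \<phi>) \<and> (\<forall>\<nu> \<psi>. eigenpair a b c \<epsilon> \<nu> \<psi> \<longrightarrow> Re \<nu> \<le> Re \<mu>)"

definition principal_eigenfunction ::
  "(real \<Rightarrow> real) \<Rightarrow> (real \<Rightarrow> real) \<Rightarrow> (real \<Rightarrow> real) \<Rightarrow> real \<Rightarrow> (real \<Rightarrow> complex) \<Rightarrow> bool" where
  "principal_eigenfunction a b c \<epsilon> \<phi> \<longleftrightarrow>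
     (\<exists>\<mu>. principal_eigenvalue a b c \<epsilon> \<mu> \<and> eigenpair a b c \<epsilon> \<mu> \<phi>)"

definition lagrangian :: "(real \<Rightarrow> real) \<Rightarrow> (real \<Rightarrow> real) \<Rightarrow> real \<Rightarrow> real \<Rightarrow> real" where
  "lagrangian a b v z = (v + b z)\<^sup>2 / (4 * a z)"

text \<open>
  The library's \<open>piecewise_C1_differentiable_on\<close> lets the derivative be unbounded near a
  breakpoint, so that the action integral could fail to exist (and would then be 0 by
  convention). Here the curve is C1 up to the endpoints on each closed piece.
\<close>

definition piecewise_C1_curve :: "real \<Rightarrow> (real \<Rightarrow> real) \<Rightarrow> bool" where
  "piecewise_C1_curve t \<eta> \<longleftrightarrow>
     (\<exists>n p. p 0 = 0 \<and> p n = t \<and>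
        (\<forall>i<n. p i < p (Suc i) \<and>
           (\<exists>D. continuous_on {p i..p (Suc i)} D \<and>
              (\<forall>s\<in>{p i..p (Suc i)}.
                 (\<eta> has_real_derivative D s) (at s within {p i..p (Suc i)})))))"

text \<open>Curves in the circle are given by their lifts to the reals.\<close>

definition circle_curves :: "real \<Rightarrow> real \<Rightarrow> real \<Rightarrow> (real \<Rightarrow> real) set" where
  "circle_curves z x t = {\<eta>. piecewise_C1_curve t \<eta> \<and> \<eta> 0 - z \<in> \<int> \<and> \<eta> t - x \<in> \<int>}"

text \<open>
  At the finitely many breakpoints \<open>deriv \<eta>\<close> may be unspecified, which does not affect the integral.
\<close>

definition mane_potential :: "(real \<Rightarrow> real) \<Rightarrow> (real \<Rightarrow> real) \<Rightarrow> real \<Rightarrow> real \<Rightarrow> real" where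
  "mane_potential a b z x =
     Inf {integral {0..t} (\<lambda>s. lagrangian a b (- deriv \<eta> s) (\<eta> s)) | t \<eta>.
            t > 0 \<and> \<eta> \<in> circle_curves z x t}"

end

theory Submission
  imports Defs
begin

text \<open>
  For \<open>W = - \<epsilon> ln u\<close> and \<open>B = b / a\<close>, the derivative \<open>w = W'\<close> solves the Riccati equation
  \<open>\<epsilon> w' = w (w - B) + \<epsilon> (c - \<mu>) / a\<close>, so as \<open>\<epsilon> \<rightarrow> 0\<close> it follows one of the roots
  \<open>0\<close> and \<open>B\<close> in the mean. A blow-up argument at \<open>x\<^sub>0\<close>, on the scale \<open>\<surd>\<epsilon>\<close>, shows that \<open>\<mu>\<close> is
  asymptotically at least the maximum \<open>c x\<^sub>0 - max 0 (b' x\<^sub>0)\<close>. Since the other zeros of \<open>b\<close>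
  have strictly smaller values, there is a strict barrier \<open>\<theta> B\<close> with \<open>0 < \<theta> < 1\<close> away from
  \<open>x\<^sub>0\<close>, which \<open>w\<close> can cross only downwards. Hence between \<open>x\<^sub>0\<close> and \<open>x\<^sub>0 + 1\<close> there is a single
  switch from the larger to the smaller root, and periodicity of \<open>W\<close> forces
  \<open>W x - W x\<^sub>0\<close> to approach the smaller of the integral of \<open>max 0 B\<close> over \<open>[x\<^sub>0, x]\<close> and that
  of \<open>max 0 (- B)\<close> over \<open>[x, x\<^sub>0 + 1]\<close>. These are the minimal actions for reaching \<open>x\<^sub>0\<close> from
  \<open>x\<close> by moving left and by moving right, so the limit is the Mane potential.
\<close>

subsection \<open>Periodic functions and antiderivatives\<close>

lemma periodic_bounded:
  fixes f :: "real \<Rightarrow> real"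
  assumes "\<And>x. f (x + 1) = f x" and "continuous_on UNIV f"
  obtains K where "K > 0" and "\<And>x. \<bar>f x\<bar> \<le> K"
proof -
  interpret periodic_fun_simple' f by unfold_locales (rule assms(1))
  have "compact (f ` {0..1})"
    by (intro compact_continuous_image continuous_on_subset[OF assms(2)]) auto
  then obtain K where K: "\<And>y. y \<in> f ` {0..1} \<Longrightarrow> norm y \<le> K"
    using compact_imp_bounded bounded_iff by metis
  have "\<bar>f x\<bar> \<le> max 1 K" for x
  proof -
    have "f x = f (frac x)"
      using plus_of_int[of "frac x" "\<lfloor>x\<rfloor>"] by (simp add: frac_def)
    moreover have "frac x \<in> {0..1}" by (simp add: frac_ge_0 less_imp_le frac_lt_1)
    ultimately show ?thesis using K[of "f x"] by auto
  qed
  then show thesis using that[of "max 1 K"] by simp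
qed

lemma periodic_attains_sup:
  fixes f :: "real \<Rightarrow> real"
  assumes "\<And>x. f (x + 1) = f x" and "continuous_on UNIV f"
  obtains m where "\<And>x. f x \<le> f m"
proof -
  interpret periodic_fun_simple' f by unfold_locales (rule assms(1))
  obtain m where m: "\<And>y. y \<in> {0..1} \<Longrightarrow> f y \<le> f m"
    using continuous_attains_sup[of "{0..1::real}" f] continuous_on_subset[OF assms(2)]
    by (metis atLeastAtMost_iff compact_Icc empty_iff order_refl subset_UNIV zero_le_one)
  have "f x \<le> f m" for x
  proof -
    have "f x = f (frac x)"
      using plus_of_int[of "frac x" "\<lfloor>x\<rfloor>"] by (simp add: frac_def)
    moreover have "frac x \<in> {0..1}" by (simp add: frac_ge_0 less_imp_le frac_lt_1)
    ultimately show ?thesis using m by simp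
  qed
  then show thesis by (rule that)
qed

lemma antiderivative_exists:
  fixes f :: "real \<Rightarrow> real"
  assumes "continuous_on UNIV f"
  obtains F where "\<And>x. (F has_real_derivative f x) (at x)"
proof -
  have "\<exists>F. \<forall>x::real. - \<infinity> < ereal x \<longrightarrow> ereal x < \<infinity> \<longrightarrow> (F has_vector_derivative f x) (at x)"
    by (intro einterval_antiderivative)
      (use assms in \<open>auto simp: continuous_on_eq_continuous_within\<close>)
  then show thesis using that by (auto simp: has_real_derivative_iff_has_vector_derivative)
qed

lemma derivative_periodic:
  fixes f :: "real \<Rightarrow> real"
  assumes "\<And>x. f (x + 1) = f x" and "\<And>x. (f has_real_derivative f' x) (at x)"
  shows "f' (x + 1) = f' x"
proof -
  have "((\<lambda>y. f (y + 1)) has_real_derivative f' (x + 1)) (at x)"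
    using assms(2)[of "x + 1"] DERIV_shift by blast
  then show ?thesis using assms(1) assms(2)[of x] DERIV_unique by (metis (no_types, lifting) ext)
qed

subsection \<open>Nonexistence of local Riccati solutions\<close>

text \<open>At its first zero \<open>D\<close> would be strictly decreasing, hence positive just
  before, and the intermediate value theorem would give an earlier zero. The criterion looks at
  \<open>D'\<close> only where \<open>D = 0\<close>, as is natural for barriers.\<close>

lemma stays_negative:
  fixes D :: "real \<Rightarrow> real"
  assumes "y \<le> z"
    and D: "\<And>x. x \<in> {y..z} \<Longrightarrow> (D has_real_derivative D' x) (at x)"
    and neg: "\<And>x. x \<in> {y..z} \<Longrightarrow> D x = 0 \<Longrightarrow> D' x < 0"
    and "D y < 0"
  shows "D z < 0"
proof (rule ccontr)
  assume "\<not> D z < 0"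
  have cont: "continuous_on {y..z} D"
    using D by (meson DERIV_continuous continuous_at_imp_continuous_on)
  define S where "S = {x \<in> {y..z}. D x = 0}"
  have "S \<noteq> {}"
    using IVT'[of D y 0 z] \<open>D y < 0\<close> \<open>\<not> D z < 0\<close> \<open>y \<le> z\<close> cont by (auto simp: S_def)
  moreover have "compact S"
    using continuous_closed_preimage_constant[OF cont, of 0]
    by (auto simp: S_def compact_eq_bounded_closed intro: bounded_subset[of "{y..z}"])
  ultimately obtain m where "m \<in> S" and m: "\<And>x. x \<in> S \<Longrightarrow> m \<le> x"
    using compact_attains_inf by metis
  then have mS: "m \<in> {y..z}" "D m = 0" by (auto simp: S_def)
  obtain d where d: "d > 0" "\<And>h. 0 < h \<Longrightarrow> h < d \<Longrightarrow> D m < D (m - h)"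
    using DERIV_neg_dec_left[OF D[OF mS(1)] neg[OF mS]] by blast
  have "y < m" using mS \<open>D y < 0\<close> by (cases "y = m") auto
  define h where "h = min (d / 2) (m - y)"
  have h: "0 < h" "h < d" "y \<le> m - h" using d(1) \<open>y < m\<close> by (auto simp: h_def min_def)
  have "D (m - h) > 0" using d(2)[of h] h mS by simp
  moreover have "continuous_on {y..m - h} D"
    using mS h by (intro continuous_on_subset[OF cont]) auto
  ultimately obtain x where "y \<le> x" "x \<le> m - h" "D x = 0"
    using IVT'[of D y 0 "m - h"] \<open>D y < 0\<close> h by auto
  then show False using m[of x] h mS by (auto simp: S_def)
qed

text \<open>As \<open>2 * k * s \<le> s\<^sup>2 + k\<^sup>2\<close>, the inequality gives
  \<open>s' \<ge> (s\<^sup>2 + k\<^sup>2) / 2\<close>, so \<open>arctan (s / k)\<close> grows at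
  rate at least \<open>k / 2\<close>. Over the length \<open>2 * pi / k\<close> it would gain
  \<open>pi\<close>, but its range is an open interval of length \<open>pi\<close>.\<close>

lemma no_long_riccati_solution:
  fixes s :: "real \<Rightarrow> real"
  assumes "k > 0" and "0 \<le> s 0"
    and s: "\<And>y. y \<in> {0..2 * pi / k} \<Longrightarrow> (s has_real_derivative s' y) (at y)"
    and ineq: "\<And>y. y \<in> {0..2 * pi / k} \<Longrightarrow> s y \<ge> 0 \<Longrightarrow> s' y \<ge> (s y)\<^sup>2 - k * s y + k\<^sup>2"
  shows False
proof -
  define R where "R = 2 * pi / k"
  have R: "R > 0" using \<open>k > 0\<close> by (simp add: R_def)
  \<comment> \<open>\<open>s\<close> cannot cross zero downwards, since
    \<open>s' \<ge> k\<^sup>2 > 0\<close> wherever \<open>s = 0\<close>. Time is reversed because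
    \<open>stays_negative\<close> propagates a negative value forwards, here from \<open>- y\<close>
    to \<open>0\<close>.\<close>
  have nonneg: "s y \<ge> 0" if y: "y \<in> {0..R}" for y
  proof (rule ccontr)
    assume "\<not> s y \<ge> 0"
    have "s (- 0) < 0"
    proof (rule stays_negative[where D = "\<lambda>t. s (- t)" and y = "- y" and z = 0 and D' = "\<lambda>t. - s' (- t)"])
      show "((\<lambda>t. s (- t)) has_real_derivative - s' (- x)) (at x)" if "x \<in> {- y..0}" for x
        using DERIV_mirror[of s "s' (- x)" x] s[of "- x"] that y
        by (simp add: R_def)
      show "- s' (- x) < 0" if "x \<in> {- y..0}" "s (- x) = 0" for x
      proof -
        have "k\<^sup>2 > 0" using \<open>k > 0\<close> by simp
        moreover have "s' (- x) \<ge> k\<^sup>2" using ineq[of "- x"] that y by (auto simp: R_def)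
        ultimately show ?thesis by linarith
      qed
    qed (use y \<open>\<not> s y \<ge> 0\<close> in auto)
    then show False using \<open>0 \<le> s 0\<close> by simp
  qed
  define A where "A y = arctan (s y / k) - k / 2 * y" for y
  have "A 0 \<le> A R"
  proof (rule DERIV_nonneg_imp_nondecreasing[where f = A])
    show "0 \<le> R" using R by simp
    fix y assume y: "0 \<le> y" "y \<le> R"
    have "(A has_real_derivative (1 / (1 + (s y / k)\<^sup>2)) * (s' y / k) - k / 2) (at y)"
      unfolding A_def
    proof (intro DERIV_diff)
      have "((\<lambda>y. s y / k) has_real_derivative s' y / k) (at y)"
        using s[of y] y by (intro DERIV_cdivide) (simp add: R_def)
      then show "((\<lambda>y. arctan (s y / k)) has_real_derivative
          (1 / (1 + (s y / k)\<^sup>2)) * (s' y / k)) (at y)"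
        using DERIV_chain2[OF DERIV_arctan, of "\<lambda>y. s y / k" "s' y / k" y UNIV]
        by (simp only: inverse_eq_divide)
    qed (auto intro!: derivative_eq_intros)
    moreover have "(1 / (1 + (s y / k)\<^sup>2)) * (s' y / k) - k / 2 \<ge> 0"
    proof -
      have "0 \<le> (s y - k)\<^sup>2" by simp
      then have "2 * (k * s y) \<le> (s y)\<^sup>2 + k\<^sup>2" by (simp add: power2_diff mult_ac)
      moreover have "s' y \<ge> (s y)\<^sup>2 - k * s y + k\<^sup>2"
        using ineq[of y] nonneg[of y] y by (simp add: R_def)
      ultimately have "s' y \<ge> ((s y)\<^sup>2 + k\<^sup>2) / 2" by simp
      then have "k * s' y / (k\<^sup>2 + (s y)\<^sup>2) \<ge> k * (((s y)\<^sup>2 + k\<^sup>2) / 2) / (k\<^sup>2 + (s y)\<^sup>2)"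
        using \<open>k > 0\<close> by (intro divide_right_mono mult_left_mono) auto
      moreover have pos: "k\<^sup>2 + (s y)\<^sup>2 > 0" using \<open>k > 0\<close> by (simp add: add_pos_nonneg)
      moreover have "(1 / (1 + (s y / k)\<^sup>2)) * (s' y / k) = k * s' y / (k\<^sup>2 + (s y)\<^sup>2)"
      proof -
        have "1 + (s y / k)\<^sup>2 = (k\<^sup>2 + (s y)\<^sup>2) / k\<^sup>2"
          using \<open>k > 0\<close> by (simp add: add_divide_distrib power_divide)
        then show ?thesis using \<open>k > 0\<close> by (simp add: power2_eq_square)
      qed
      moreover have "k * (((s y)\<^sup>2 + k\<^sup>2) / 2) / (k\<^sup>2 + (s y)\<^sup>2) = k / 2"
      proof -
        have "k * (Q / 2) / Q = k / 2" if "Q \<noteq> 0" for Q :: real using that by simp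
        from this[of "k\<^sup>2 + (s y)\<^sup>2"] show ?thesis using pos by (simp only: add.commute)
      qed
      ultimately show ?thesis by linarith
    qed
    ultimately show "\<exists>d. (A has_real_derivative d) (at y) \<and> 0 \<le> d" by blast
  qed
  then have "arctan (s R / k) - arctan (s 0 / k) \<ge> pi"
    using \<open>k > 0\<close> by (simp add: A_def R_def)
  then show False
    using arctan_bounded[of "s R / k"] arctan_bounded[of "s 0 / k"] by linarith
qed

text \<open>Blow-up on the scale \<open>q = sqrt \<epsilon>\<close>:
  \<open>s y = v (x0 + q * y) / q\<close> satisfies \<open>s' = s\<^sup>2 + (g / q) * s + d\<close>,
  without the small factor in front of the derivative. On \<open>[0, 2 * pi / k]\<close> the bounds
  on \<open>g\<close> and \<open>\<kappa>\<close> give \<open>g / q \<ge> - k\<close>. If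
  \<open>v x0 \<le> 0\<close>, the same is done to the left of \<open>x0\<close> with the sign of
  \<open>v\<close> reversed.\<close>

lemma no_local_riccati_solution:
  fixes v :: "real \<Rightarrow> real"
  assumes "\<epsilon> > 0" "k > 0" and r: "2 * pi / k * sqrt \<epsilon> \<le> r" and \<kappa>: "0 \<le> \<kappa>" "\<kappa> * (2 * pi / k) \<le> k"
    and v: "\<And>x. (v has_real_derivative v' x) (at x)"
    and eq: "\<And>x. \<epsilon> * v' x = (v x)\<^sup>2 + g x * v x + \<epsilon> * d x"
    and g: "\<And>h. 0 \<le> h \<Longrightarrow> h \<le> r \<Longrightarrow> g (x0 + h) \<ge> - \<kappa> * h \<and> g (x0 - h) \<le> \<kappa> * h"
    and d: "\<And>h. \<bar>h\<bar> \<le> r \<Longrightarrow> d (x0 + h) \<ge> k\<^sup>2"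
  shows False
proof -
  define q where "q = sqrt \<epsilon>"
  have q: "q > 0" "q * q = \<epsilon>" using \<open>\<epsilon> > 0\<close> by (auto simp: q_def)
  have eq': "v' x = (v x / q)\<^sup>2 + (g x / q) * (v x / q) + d x" for x
  proof -
    have "q * q * v' x = v x * v x + g x * v x + q * q * d x"
      using eq[of x] q by (simp add: power2_eq_square)
    then show ?thesis using q(1) by (simp add: field_simps power2_eq_square)
  qed
  have bnd: "q * y \<le> r" "\<kappa> * y \<le> k" "0 \<le> q * y" if "y \<in> {0..2 * pi / k}" for y
  proof -
    have "q * y \<le> q * (2 * pi / k)" using that q by (intro mult_left_mono) auto
    then show "q * y \<le> r" using r by (simp add: q_def mult.commute)
    have "\<kappa> * y \<le> \<kappa> * (2 * pi / k)" using that \<kappa> by (intro mult_left_mono) auto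
    then show "\<kappa> * y \<le> k" using \<kappa> by linarith
  qed (use q that in auto)
  consider "v x0 \<ge> 0" | "v x0 \<le> 0" by linarith
  then show False
  proof cases
    case 1
    define s where "s y = v (x0 + q * y) / q" for y
    show False
    proof (rule no_long_riccati_solution[where s = s and k = k and s' = "\<lambda>y. v' (x0 + q * y)"])
      show "(s has_real_derivative v' (x0 + q * y)) (at y)" for y
        unfolding s_def using q
        by (auto intro!: derivative_eq_intros DERIV_chain2[OF v])
      fix y assume y: "y \<in> {0..2 * pi / k}" and s0: "s y \<ge> 0"
      have "g (x0 + q * y) / q \<ge> - \<kappa> * y"
        using g[of "q * y"] bnd[OF y] q by (simp add: field_simps)
      then have "g (x0 + q * y) / q \<ge> - k" using bnd[OF y] by linarith
      then have "g (x0 + q * y) / q * s y \<ge> - k * s y" using s0 by (intro mult_right_mono) auto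
      moreover have "d (x0 + q * y) \<ge> k\<^sup>2" using d[of "q * y"] bnd[OF y] by simp
      ultimately show "v' (x0 + q * y) \<ge> (s y)\<^sup>2 - k * s y + k\<^sup>2"
        using eq'[of "x0 + q * y"] unfolding s_def[symmetric] by linarith
    qed (use 1 q \<open>k > 0\<close> in \<open>auto simp: s_def\<close>)
  next
    case 2
    define s where "s y = - (v (x0 - q * y) / q)" for y
    show False
    proof (rule no_long_riccati_solution[where s = s and k = k and s' = "\<lambda>y. v' (x0 - q * y)"])
      show "(s has_real_derivative v' (x0 - q * y)) (at y)" for y
        unfolding s_def using q
        by (auto intro!: derivative_eq_intros DERIV_chain2[OF v])
      fix y assume y: "y \<in> {0..2 * pi / k}" and s0: "s y \<ge> 0"
      have "g (x0 - q * y) / q \<le> \<kappa> * y"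
        using g[of "q * y"] bnd[OF y] q by (simp add: field_simps)
      then have "g (x0 - q * y) / q \<le> k" using bnd[OF y] by linarith
      then have "g (x0 - q * y) / q * s y \<le> k * s y" using s0 by (intro mult_right_mono) auto
      moreover have "d (x0 - q * y) \<ge> k\<^sup>2" using d[of "- (q * y)"] bnd[OF y] by simp
      moreover have "v (x0 - q * y) / q = - s y" by (simp add: s_def)
      ultimately show "v' (x0 - q * y) \<ge> (s y)\<^sup>2 - k * s y + k\<^sup>2"
        using eq'[of "x0 - q * y"] by simp
    qed (use 2 q \<open>k > 0\<close> in \<open>auto simp: s_def field_simps\<close>)
  qed
qed

text \<open>Adding the tilt \<open>\<kappa> * (x - x0)\<close> makes the derivative at
  \<open>x0\<close> strictly positive even if \<open>D = 0\<close>, so near \<open>x0\<close> the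
  tilted function has the sign of \<open>x - x0\<close>.\<close>

lemma sign_near_zero:
  fixes f :: "real \<Rightarrow> real"
  assumes f: "(f has_real_derivative D) (at x0)" and "f x0 = 0" "D \<ge> 0" "\<kappa> > 0"
  obtains r where "r > 0"
    and "\<And>h. 0 \<le> h \<Longrightarrow> h < r \<Longrightarrow> f (x0 + h) \<ge> - \<kappa> * h \<and> f (x0 - h) \<le> \<kappa> * h"
proof -
  define \<phi> where "\<phi> x = f x + \<kappa> * (x - x0)" for x
  have d: "(\<phi> has_real_derivative D + \<kappa>) (at x0)"
    unfolding \<phi>_def by (auto intro!: derivative_eq_intros f)
  obtain r1 where r1: "r1 > 0" "\<And>h. 0 < h \<Longrightarrow> h < r1 \<Longrightarrow> \<phi> x0 < \<phi> (x0 + h)"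
    using has_real_derivative_pos_inc_right[OF d] assms by auto
  obtain r2 where r2: "r2 > 0" "\<And>h. 0 < h \<Longrightarrow> h < r2 \<Longrightarrow> \<phi> (x0 - h) < \<phi> x0"
    using has_real_derivative_pos_inc_left[OF d] assms by auto
  show thesis
  proof
    show "min r1 r2 > 0" using r1 r2 by simp
    fix h assume "0 \<le> h" "h < min r1 r2"
    then show "f (x0 + h) \<ge> - \<kappa> * h \<and> f (x0 - h) \<le> \<kappa> * h"
      using r1(2)[of h] r2(2)[of h] assms by (cases "h = 0") (auto simp: \<phi>_def)
  qed
qed

text \<open>The threshold is fixed before \<open>v\<close> and \<open>d\<close>, because
  \<open>d\<close> will contain the unknown eigenvalue: an eigenvalue that is too small makes
  \<open>d\<close> at least a fixed function \<open>d0\<close>.\<close>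

lemma no_small_riccati_solution:
  fixes g d0 :: "real \<Rightarrow> real"
  assumes g: "(g has_real_derivative D) (at x0)" "g x0 = 0" "D \<ge> 0"
    and d0: "continuous_on UNIV d0" "d0 x0 > 0"
  obtains \<epsilon>0 where "\<epsilon>0 > 0"
    and "\<And>\<epsilon> v v' d. 0 < \<epsilon> \<Longrightarrow> \<epsilon> < \<epsilon>0 \<Longrightarrow> (\<And>x. (v has_real_derivative v' x) (at x)) \<Longrightarrow>
           (\<And>x. \<epsilon> * v' x = (v x)\<^sup>2 + g x * v x + \<epsilon> * d x) \<Longrightarrow> (\<And>x. d x \<ge> d0 x) \<Longrightarrow> False"
proof -
  \<comment> \<open>Halving leaves room for \<open>d0 > k\<^sup>2\<close> near \<open>x0\<close>,
    and \<open>\<kappa>\<close> is such that the bound \<open>\<kappa> * y\<close> reaches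
    \<open>k\<close> exactly at the end \<open>y = 2 * pi / k\<close>.\<close>
  define k where "k = sqrt (d0 x0 / 2)"
  have k: "k > 0" "k\<^sup>2 = d0 x0 / 2" using d0 by (auto simp: k_def)
  define \<kappa> where "\<kappa> = k / (2 * pi / k)"
  have \<kappa>: "\<kappa> > 0" "\<kappa> * (2 * pi / k) = k" using k by (auto simp: \<kappa>_def)
  obtain r1 where r1: "r1 > 0"
    "\<And>h. 0 \<le> h \<Longrightarrow> h < r1 \<Longrightarrow> g (x0 + h) \<ge> - \<kappa> * h \<and> g (x0 - h) \<le> \<kappa> * h"
    using sign_near_zero[OF g \<kappa>(1)] by metis
  have "d0 \<midarrow>x0\<rightarrow> d0 x0"
    using d0(1) by (simp add: continuous_on_eq_continuous_at isCont_def)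
  then obtain r2 where r2: "r2 > 0" "\<And>x. \<bar>x - x0\<bar> < r2 \<Longrightarrow> \<bar>d0 x - d0 x0\<bar> < k\<^sup>2"
    using LIM_D[of d0 "d0 x0" x0 "k\<^sup>2"] k
    by (metis abs_0 diff_self real_norm_def zero_less_power)
  define r where "r = min r1 r2 / 2"
  have r: "r > 0" "r < r1" "r < r2" using r1(1) r2(1) by (auto simp: r_def min_def)
  show thesis
  proof
    show "(r / (2 * pi / k))\<^sup>2 > 0" using r k by simp
    fix \<epsilon> v v' d
    assume \<epsilon>: "0 < \<epsilon>" "\<epsilon> < (r / (2 * pi / k))\<^sup>2"
      and v: "\<And>x. (v has_real_derivative v' x) (at x)"
        "\<And>x. \<epsilon> * v' x = (v x)\<^sup>2 + g x * v x + \<epsilon> * d x" and d: "\<And>x. d x \<ge> d0 x"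
    have "sqrt \<epsilon> \<le> r / (2 * pi / k)"
      using \<epsilon> r k by (intro real_le_lsqrt) auto
    then have le: "2 * pi / k * sqrt \<epsilon> \<le> r" using k by (simp add: field_simps)
    have dk: "d (x0 + h) \<ge> k\<^sup>2" if "\<bar>h\<bar> \<le> r" for h
      using r2(2)[of "x0 + h"] d[of "x0 + h"] that r k(2) by (simp add: abs_if split: if_splits)
    show False
      by (rule no_local_riccati_solution[where g = g and d = d and \<epsilon> = \<epsilon> and k = k and r = r
            and \<kappa> = \<kappa> and v = v and v' = v' and ?x0.0 = x0])
        (use \<epsilon> k(1) le \<kappa> v dk r1(2) r in auto)
  qed
qed

subsection \<open>Barriers and error estimates\<close>

text \<open>Only the compact set where \<open>g \<ge> 0\<close> matters: there \<open>h\<close> is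
  positive, hence has a positive minimum, and \<open>g\<close> has a maximum. Elsewhere
  \<open>\<epsilon> * g < 0 \<le> h\<close>.\<close>

lemma small_parameter_domination:
  fixes g h :: "real \<Rightarrow> real"
  assumes "compact K" "continuous_on K g" "continuous_on K h"
    and "\<And>x. x \<in> K \<Longrightarrow> h x \<ge> 0" and "\<And>x. x \<in> K \<Longrightarrow> h x = 0 \<Longrightarrow> g x < 0"
  obtains \<epsilon>0 where "\<epsilon>0 > 0" and "\<And>\<epsilon> x. 0 < \<epsilon> \<Longrightarrow> \<epsilon> < \<epsilon>0 \<Longrightarrow> x \<in> K \<Longrightarrow> \<epsilon> * g x < h x"
proof -
  define K' where "K' = {x \<in> K. g x \<ge> 0}"
  have "closed (K \<inter> g -` {0..})"
    using assms(2) compact_imp_closed[OF assms(1)]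
    by (intro continuous_closed_preimage) auto
  moreover have "K' = K \<inter> g -` {0..}" by (auto simp: K'_def)
  ultimately have K': "compact K'"
    using assms(1) unfolding compact_eq_bounded_closed by (metis bounded_Int)
  show thesis
  proof (cases "K' = {}")
    case True
    have "\<epsilon> * g x < h x" if "0 < \<epsilon>" "x \<in> K" for \<epsilon> x
    proof -
      have "g x < 0" using True that by (force simp: K'_def)
      then have "\<epsilon> * g x < 0" using that by (simp add: mult_pos_neg)
      then show ?thesis using assms(4)[OF that(2)] by linarith
    qed
    then show thesis using that[of 1] by simp
  next
    case False
    have sub: "K' \<subseteq> K" by (auto simp: K'_def)
    obtain m where m: "m \<in> K'" "\<And>x. x \<in> K' \<Longrightarrow> h m \<le> h x"
      using continuous_attains_inf[OF K' False continuous_on_subset[OF assms(3) sub]] by blast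
    obtain n where n: "n \<in> K'" "\<And>x. x \<in> K' \<Longrightarrow> g x \<le> g n"
      using continuous_attains_sup[OF K' False continuous_on_subset[OF assms(2) sub]] by blast
    have hm: "h m > 0" using assms(4,5)[of m] m(1) by (force simp: K'_def)
    have gn: "g n \<ge> 0" using n by (simp add: K'_def)
    show thesis
    proof
      show "h m / (g n + 1) > 0" using hm gn by simp
      fix \<epsilon> x assume \<epsilon>: "0 < \<epsilon>" "\<epsilon> < h m / (g n + 1)" and x: "x \<in> K"
      show "\<epsilon> * g x < h x"
      proof (cases "g x \<ge> 0")
        case True
        then have "x \<in> K'" using x by (simp add: K'_def)
        have "\<epsilon> * g x \<le> \<epsilon> * g n" using n(2)[OF \<open>x \<in> K'\<close>] \<epsilon> by simp
        also have "\<dots> < h m" using \<epsilon> gn by (simp add: field_simps)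
        also have "\<dots> \<le> h x" using m(2) \<open>x \<in> K'\<close> .
        finally show ?thesis .
      next
        case False
        then have "\<epsilon> * g x < 0" using \<epsilon> by (simp add: mult_pos_neg)
        then show ?thesis using assms(4)[OF x] by linarith
      qed
    qed
  qed
qed

text \<open>
  The separator \<open>\<theta>\<close> is a smoothed Heaviside function of a difference quotient of \<open>F\<close>, which is
  \<open>C\<^sup>1\<close> although the derivative \<open>f\<close> of \<open>F\<close> is only continuous.
\<close>

lemma smooth_positive_part:
  fixes F f :: "real \<Rightarrow> real"
  assumes F: "\<And>x. (F has_real_derivative f x) (at x)" and f: "continuous_on UNIV f" and "\<tau> > 0"
  obtains \<theta> \<theta>' where "\<And>x. (\<theta> has_real_derivative \<theta>' x) (at x)" "continuous_on UNIV \<theta>'"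
    "\<And>x. 0 < \<theta> x" "\<And>x. \<theta> x < 1" "\<And>x. x \<in> {l..r} \<Longrightarrow> \<theta> x * f x \<ge> max 0 (f x) - \<tau>"
proof -
  \<comment> \<open>Three losses have to fit into \<open>\<tau>\<close>: at most
    \<open>t / 2\<close> for smoothing the sign of \<open>q\<close>, and at most \<open>t\<close>
    each for replacing \<open>f\<close> by \<open>q\<close> in the product and in the positive
    part.\<close>
  define t where "t = \<tau> / 3"
  have t: "t > 0" using \<open>\<tau> > 0\<close> by (simp add: t_def)
  have "uniformly_continuous_on {l..r + 1} f"
    by (intro compact_uniformly_continuous continuous_on_subset[OF f]) auto
  then obtain d where d: "d > 0"
    "\<And>x y. x \<in> {l..r + 1} \<Longrightarrow> y \<in> {l..r + 1} \<Longrightarrow> dist y x < d \<Longrightarrow> dist (f y) (f x) < t"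
    using t unfolding uniformly_continuous_on_def by metis
  define h where "h = min 1 (d / 2)"
  have h: "0 < h" "h \<le> 1" "h < d" using d(1) by (auto simp: h_def min_def)
  define q where "q x = (F (x + h) - F x) / h" for x
  define q' where "q' x = (f (x + h) - f x) / h" for x
  \<comment> \<open>\<open>S\<close> is a differentiable version of \<open>\<bar>q\<bar>\<close>,
    strictly larger but by at most \<open>t\<close>. Thus \<open>q / S\<close> approximates the sign
    of \<open>q\<close> with values strictly between -1 and 1.\<close>
  define S where "S x = sqrt ((q x)\<^sup>2 + t\<^sup>2)" for x
  have S: "S x > 0" "\<bar>q x\<bar> < S x" "S x \<le> \<bar>q x\<bar> + t" "(S x)\<^sup>2 = (q x)\<^sup>2 + t\<^sup>2" for x
  proof -
    show "S x > 0" unfolding S_def using t by (simp add: add_nonneg_pos)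
    show "\<bar>q x\<bar> < S x" unfolding S_def using t by (intro real_less_rsqrt) simp
    show "S x \<le> \<bar>q x\<bar> + t" unfolding S_def using t
      by (intro real_le_lsqrt) (auto simp: power2_sum)
    show "(S x)\<^sup>2 = (q x)\<^sup>2 + t\<^sup>2" unfolding S_def by simp
  qed
  have q: "(q has_real_derivative q' x) (at x)" for x
    unfolding q_def q'_def using h
    by (auto intro!: derivative_eq_intros DERIV_chain2[OF F] F)
  have S': "(S has_real_derivative q x * q' x / S x) (at x)" for x
  proof -
    have q2: "((\<lambda>x. (q x)\<^sup>2 + t\<^sup>2) has_real_derivative 2 * q x * q' x) (at x)"
      by (auto intro!: derivative_eq_intros q)
    have "(q x)\<^sup>2 + t\<^sup>2 > 0" using t by (simp add: add_nonneg_pos)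
    then have "(S has_real_derivative inverse (sqrt ((q x)\<^sup>2 + t\<^sup>2)) / 2 * (2 * q x * q' x)) (at x)"
      unfolding S_def by (rule DERIV_chain2[OF DERIV_real_sqrt q2])
    moreover have "inverse (sqrt ((q x)\<^sup>2 + t\<^sup>2)) / 2 * (2 * q x * q' x) = q x * q' x / S x"
      by (simp add: S_def inverse_eq_divide mult_ac)
    ultimately show ?thesis by metis
  qed
  have cont: "continuous_on UNIV q" "continuous_on UNIV S"
    by (rule DERIV_continuous_on[OF q] DERIV_continuous_on[OF S'])+
  have "continuous_on UNIV (\<lambda>x. f (x + h))"
    by (rule continuous_on_compose2[OF f]) (auto intro!: continuous_intros)
  then have cont': "continuous_on UNIV q'"
    unfolding q'_def using h f by (intro continuous_intros) auto
  define \<theta> where "\<theta> x = (1 + q x / S x) / 2" for x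
  define \<theta>' where "\<theta>' x = (q' x * S x - q x * (q x * q' x / S x)) / (S x * S x) / 2" for x
  show thesis
  proof
    show "(\<theta> has_real_derivative \<theta>' x) (at x)" for x
      unfolding \<theta>_def \<theta>'_def using S(1)[of x]
      by (auto intro!: derivative_eq_intros q S' simp: field_simps)
    show "continuous_on UNIV \<theta>'"
      unfolding \<theta>'_def using S(1)
      by (intro continuous_intros cont cont') (metis less_irrefl mult_eq_0_iff zero_neq_numeral)+
    show \<theta>01: "0 < \<theta> x" "\<theta> x < 1" for x
      using S(1,2)[of x] by (auto simp: \<theta>_def field_simps abs_less_iff)
    fix x assume x: "x \<in> {l..r}"
    obtain z where z: "x < z" "z < x + h" "F (x + h) - F x = h * f z"
      using MVT2[of x "x + h" F f] F h by auto
    then have "q x = f z" using h by (simp add: q_def)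
    then have qf: "\<bar>q x - f x\<bar> < t"
      using d(2)[of x z] z x h by (simp add: dist_real_def)
    have "(q x)\<^sup>2 \<ge> (\<bar>q x\<bar> - t) * S x"
    proof (cases "\<bar>q x\<bar> \<ge> t")
      case True
      then have "(\<bar>q x\<bar> - t) * S x \<le> (\<bar>q x\<bar> - t) * (\<bar>q x\<bar> + t)"
        using S(3)[of x] by (intro mult_left_mono) auto
      also have "\<dots> \<le> (q x)\<^sup>2" by (simp add: algebra_simps power2_eq_square)
      finally show ?thesis .
    next
      case False
      then have "(\<bar>q x\<bar> - t) * S x \<le> 0" using S(1)[of x] by (simp add: mult_nonpos_nonneg)
      then show ?thesis by (smt (verit) zero_le_power2)
    qed
    then have "q x * (q x / S x) \<ge> \<bar>q x\<bar> - t"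
      using S(1)[of x] by (simp add: field_simps power2_eq_square)
    moreover have "\<theta> x * q x = (q x + q x * (q x / S x)) / 2"
      by (simp add: \<theta>_def ring_distribs)
    ultimately have "\<theta> x * q x \<ge> max 0 (q x) - t / 2"
      by (cases "0 \<le> q x") (simp_all add: max_def)
    moreover have "\<bar>\<theta> x * (q x - f x)\<bar> \<le> 1 * t"
      unfolding abs_mult using \<theta>01[of x] qf by (intro mult_mono) auto
    ultimately show "\<theta> x * f x \<ge> max 0 (f x) - \<tau>"
      using qf unfolding right_diff_distrib t_def by linarith
  qed
qed

text \<open>
  Here \<open>w\<close> lies on the side of \<open>\<theta> B\<close> belonging to the larger root \<open>max 0 B\<close> of \<open>w (w - B)\<close>.
\<close>

lemma distance_to_larger_root:
  fixes w B \<theta> :: real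
  assumes "0 < \<sigma>" "\<sigma> \<le> \<theta>" "\<theta> \<le> 1 - \<sigma>" "w \<ge> \<theta> * B"
  shows "\<sigma> * (w - max 0 B)\<^sup>2 \<le> \<bar>w * (w - B)\<bar>"
proof -
  have \<sigma>: "\<sigma> \<le> 1" using assms by linarith
  have shrink: "\<sigma> * y\<^sup>2 \<le> z" if "y\<^sup>2 \<le> z" for y z :: real
  proof -
    have "\<sigma> * y\<^sup>2 \<le> 1 * y\<^sup>2" using \<sigma> by (intro mult_right_mono) auto
    then show ?thesis using that by simp
  qed
  consider "B \<ge> 0" "w \<ge> B" | "B \<ge> 0" "w < B" | "B < 0" "w \<ge> 0" | "B < 0" "w < 0" by linarith
  then show ?thesis
  proof cases
    case 1
    then have "(w - B)\<^sup>2 \<le> w * (w - B)" by (simp add: power2_eq_square mult_right_mono)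
    then show ?thesis using 1 shrink[of "w - B"] by (simp add: max_def abs_if split: if_splits)
  next
    case 2
    have "\<sigma> * B \<le> \<theta> * B" using assms 2 by (intro mult_right_mono) auto
    then have w: "\<sigma> * B \<le> w" using assms by linarith
    have "\<sigma> * (B - w) \<le> \<sigma> * B" using assms 2 w
      by (smt (verit) mult_left_mono mult_nonneg_nonneg)
    then have "\<sigma> * (B - w) * (B - w) \<le> w * (B - w)"
      using w 2 by (intro mult_right_mono) auto
    moreover have "\<bar>w * (w - B)\<bar> \<ge> - (w * (w - B))" by (rule abs_ge_minus_self)
    ultimately show ?thesis using 2 by (simp add: max_def power2_eq_square algebra_simps)
  next
    case 3
    then have "w\<^sup>2 \<le> w * (w - B)" by (simp add: power2_eq_square mult_left_mono)
    then show ?thesis using 3 shrink[of w] by (simp add: max_def abs_if split: if_splits)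
  next
    case 4
    have "\<theta> * (- B) \<le> (1 - \<sigma>) * (- B)" using assms 4 by (intro mult_right_mono) auto
    then have "- w \<le> (1 - \<sigma>) * (- B)" using assms by linarith
    moreover have "\<sigma> * (- B) \<ge> 0" using assms 4 by (intro mult_nonneg_nonneg) auto
    ultimately have w: "w - B \<ge> \<sigma> * (- B)" "- B \<ge> - w" by (auto simp: algebra_simps)
    have "\<sigma> * (- w) \<le> \<sigma> * (- B)" using assms w by (intro mult_left_mono) auto
    then have "\<sigma> * (- w) \<le> w - B" using w by linarith
    then have "\<sigma> * (- w) * (- w) \<le> (w - B) * (- w)"
      using 4 by (intro mult_right_mono) auto
    moreover have "\<bar>w * (w - B)\<bar> \<ge> - (w * (w - B))" by (rule abs_ge_minus_self)
    ultimately show ?thesis using 4 by (simp add: max_def power2_eq_square algebra_simps)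
  qed
qed

text \<open>If the error \<open>e\<close> exceeds \<open>\<tau>\<close>, then
  \<open>\<sigma> * \<tau> * e \<le> \<sigma> * e\<^sup>2\<close>, which makes the quadratic
  estimate linear in the residual \<open>w * (w - B)\<close>. Linearity is the point: the Riccati
  equation then expresses the bound through \<open>\<epsilon> * w'\<close>, which integrates
  exactly. The term \<open>2 * max 0 \<eta>\<close> arises because a number
  \<open>y \<le> \<eta>\<close> has \<open>\<bar>y\<bar> \<le> 2 * max 0 \<eta> - y\<close>.\<close>

lemma error_bound_from_residual:
  fixes w B \<theta> :: real
  assumes "0 < \<sigma>" "\<sigma> \<le> \<theta>" "\<theta> \<le> 1 - \<sigma>" "w \<ge> \<theta> * B" "w * (w - B) \<le> \<eta>" "0 < \<tau>"
  shows "\<bar>w - max 0 B\<bar> \<le> \<tau> + (2 * max 0 \<eta> - w * (w - B)) / (\<sigma> * \<tau>)"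
proof -
  define e where "e = \<bar>w - max 0 B\<bar>"
  have "\<sigma> * e\<^sup>2 \<le> \<bar>w * (w - B)\<bar>"
    using distance_to_larger_root[OF assms(1-4)] by (simp add: e_def)
  then have *: "\<sigma> * e\<^sup>2 \<le> 2 * max 0 \<eta> - w * (w - B)"
    using assms(5) by (auto simp: abs_if max_def split: if_splits)
  have "0 \<le> \<sigma> * e\<^sup>2" using assms by simp
  then have nn: "2 * max 0 \<eta> - w * (w - B) \<ge> 0" using * by linarith
  show ?thesis
  proof (cases "e \<le> \<tau>")
    case True
    then show ?thesis using nn assms by (simp add: e_def add_increasing2)
  next
    case False
    have "\<sigma> * \<tau> * e \<le> \<sigma> * e * e" using False assms by (intro mult_right_mono) auto
    also have "\<dots> \<le> 2 * max 0 \<eta> - w * (w - B)"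
      using * by (simp add: power2_eq_square mult.assoc)
    finally have "e \<le> (2 * max 0 \<eta> - w * (w - B)) / (\<sigma> * \<tau>)"
      using assms by (simp add: field_simps)
    then show ?thesis using assms by (simp add: e_def)
  qed
qed

text \<open>The mean value theorem is applied to \<open>\<kappa> * x - k * w x - s * D x\<close>
  with \<open>s = 1\<close> and \<open>s = -1\<close>. However large \<open>w'\<close> is pointwise,
  its term contributes only the increment of \<open>w\<close>.\<close>

lemma derivative_error_integrated:
  fixes D w :: "real \<Rightarrow> real"
  assumes "l \<le> m" and D: "\<And>x. (D has_real_derivative D' x) (at x)"
    and w: "\<And>x. (w has_real_derivative w' x) (at x)"
    and bound: "\<And>x. l < x \<Longrightarrow> x < m \<Longrightarrow> \<bar>D' x\<bar> \<le> \<kappa> - k * w' x"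
  shows "\<bar>D m - D l\<bar> \<le> \<kappa> * (m - l) - k * (w m - w l)"
proof (cases "l = m")
  case False
  then have lm: "l < m" using \<open>l \<le> m\<close> by simp
  have le: "s * (D m - D l) \<le> \<kappa> * (m - l) - k * (w m - w l)" if s: "\<bar>s\<bar> = 1" for s
  proof -
    define f where "f x = \<kappa> * x - k * w x - s * D x" for x
    have "(f has_real_derivative \<kappa> - k * w' x - s * D' x) (at x)" for x
      unfolding f_def by (auto intro!: derivative_eq_intros D w)
    then obtain z where z: "l < z" "z < m" "f m - f l = (m - l) * (\<kappa> - k * w' z - s * D' z)"
      using MVT2[OF lm, of f "\<lambda>x. \<kappa> - k * w' x - s * D' x"] by blast
    have "s * D' z \<le> \<bar>D' z\<bar>" using s by (metis abs_ge_self abs_mult mult_1)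
    then have "\<kappa> - k * w' z - s * D' z \<ge> 0" using bound[OF z(1,2)] by linarith
    then have "f m - f l \<ge> 0" using z(3) lm by simp
    then show ?thesis by (simp add: f_def algebra_simps)
  qed
  show ?thesis using le[of 1] le[of "-1"] by (simp add: abs_le_iff)
qed simp

text \<open>By \<open>stay\<close>, the set where \<open>w < p\<close> is closed under moving right
  within \<open>[l, r]\<close>; \<open>T\<close> is its infimum, or \<open>r\<close> if it is empty.
  Nothing is claimed at \<open>T\<close> itself.\<close>

lemma switching_point:
  fixes w p :: "real \<Rightarrow> real"
  assumes "l \<le> r"
    and stay: "\<And>y z. l \<le> y \<Longrightarrow> y \<le> z \<Longrightarrow> z \<le> r \<Longrightarrow> w y < p y \<Longrightarrow> w z < p z"
  obtains T where "l \<le> T" "T \<le> r" "\<And>x. l \<le> x \<Longrightarrow> x < T \<Longrightarrow> w x \<ge> p x"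
    "\<And>x. T < x \<Longrightarrow> x \<le> r \<Longrightarrow> w x \<le> p x"
proof -
  define S where "S = {x \<in> {l..r}. w x < p x}"
  show thesis
  proof (cases "S = {}")
    case True
    then have "w x \<ge> p x" if "l \<le> x" "x \<le> r" for x
      using that by (force simp: S_def)
    then show thesis using that[of r] \<open>l \<le> r\<close> by force
  next
    case False
    have bdd: "bdd_below S" unfolding S_def by (rule bdd_belowI[of _ l]) auto
    show thesis
    proof (rule that[of "Inf S"])
      show "l \<le> Inf S" using False by (intro cInf_greatest) (auto simp: S_def)
      obtain s where "s \<in> S" using False by blast
      then show "Inf S \<le> r" using cInf_lower[OF \<open>s \<in> S\<close> bdd] by (simp add: S_def)
      show "w x \<ge> p x" if "l \<le> x" "x < Inf S" for x
        using that cInf_lower[OF _ bdd, of x] \<open>Inf S \<le> r\<close> by (force simp: S_def)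
      show "w x \<le> p x" if "Inf S < x" "x \<le> r" for x
      proof -
        obtain s where "s \<in> S" "s < x" using cInf_lessD[OF False \<open>Inf S < x\<close>] by blast
        then show ?thesis using stay[of s x] that by (simp add: S_def less_imp_le)
      qed
    qed
  qed
qed

subsection \<open>The Riccati equation on the circle\<close>

locale circle_operator =
  fixes a a' b b' c :: "real \<Rightarrow> real"
  assumes a_periodic: "a (x + 1) = a x" and b_periodic: "b (x + 1) = b x"
    and c_periodic: "c (x + 1) = c x"
    and a_pos: "a x > 0"
    and a_deriv: "(a has_real_derivative a' x) (at x)"
    and b_deriv: "(b has_real_derivative b' x) (at x)"
    and a'_cont: "continuous_on UNIV a'" and b'_cont: "continuous_on UNIV b'"
    and c_cont: "continuous_on UNIV c"
begin

definition B :: "real \<Rightarrow> real" where "B x = b x / a x"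

definition B' :: "real \<Rightarrow> real" where "B' x = (b' x * a x - b x * a' x) / (a x * a x)"

text \<open>
  With \<open>W = - \<epsilon> ln u\<close>, \<open>w = W'\<close> and \<open>w' = W''\<close>, this is the equation
  \<open>\<epsilon> a u'' + b u' + c u = \<mu> u\<close> after division by \<open>- a u / \<epsilon>\<close>.
\<close>

definition riccati ::
  "real \<Rightarrow> real \<Rightarrow> (real \<Rightarrow> real) \<Rightarrow> (real \<Rightarrow> real) \<Rightarrow> (real \<Rightarrow> real) \<Rightarrow> bool" where
  "riccati \<epsilon> \<mu> W w w' \<longleftrightarrow>
     (\<forall>x. W (x + 1) = W x) \<and>
     (\<forall>x. (W has_real_derivative w x) (at x)) \<and>
     (\<forall>x. (w has_real_derivative w' x) (at x)) \<and>
     (\<forall>x. \<epsilon> * w' x = w x * (w x - B x) + \<epsilon> * ((c x - \<mu>) / a x))"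

lemma riccatiD:
  assumes "riccati \<epsilon> \<mu> W w w'"
  shows "W (x + 1) = W x" "(W has_real_derivative w x) (at x)"
    "(w has_real_derivative w' x) (at x)"
    "\<epsilon> * w' x = w x * (w x - B x) + \<epsilon> * ((c x - \<mu>) / a x)"
    "w (x + 1) = w x"
  using assms derivative_periodic[of W w x] by (auto simp: riccati_def)

lemma a_nonzero [simp]: "a x \<noteq> 0"
  using a_pos[of x] by simp

lemma a_cont: "continuous_on UNIV a"
  by (rule DERIV_continuous_on[OF a_deriv])

lemma b_cont: "continuous_on UNIV b"
  by (rule DERIV_continuous_on[OF b_deriv])

lemma B_deriv: "(B has_real_derivative B' x) (at x)"
proof -
  have "((\<lambda>x. b x / a x) has_real_derivative B' x) (at x)"
    unfolding B'_def by (rule DERIV_divide[OF b_deriv a_deriv]) simp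
  then show ?thesis by (simp add: B_def[abs_def])
qed

lemma B_cont: "continuous_on UNIV B"
  by (rule DERIV_continuous_on[OF B_deriv])

lemma B'_cont: "continuous_on UNIV B'"
  unfolding B'_def by (intro continuous_intros a_cont b_cont a'_cont b'_cont) auto

lemma B_periodic: "B (x + 1) = B x"
  by (simp add: B_def a_periodic b_periodic)

lemma B'_periodic: "B' (x + 1) = B' x"
  by (rule derivative_periodic[OF B_periodic B_deriv])

lemma B'_at_zero: "b x = 0 \<Longrightarrow> B' x = b' x / a x"
  by (simp add: B'_def)

text \<open>
  If \<open>b'\<close> is positive at the zero \<open>x0\<close> of \<open>b\<close>, then \<open>w - B\<close> solves the dual Riccati equation,
  in which \<open>b\<close> has changed sign.
\<close>

lemma eigenvalue_lower_bound:
  assumes "b x0 = 0" and "\<delta> > 0"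
  obtains \<epsilon>0 where "\<epsilon>0 > 0"
    and "\<And>\<epsilon> \<mu> W w w'. 0 < \<epsilon> \<Longrightarrow> \<epsilon> < \<epsilon>0 \<Longrightarrow> riccati \<epsilon> \<mu> W w w' \<Longrightarrow>
           c x0 - max 0 (b' x0) - \<delta> \<le> \<mu>"
proof (cases "b' x0 \<le> 0")
  case True
  \<comment> \<open>This is the zero-order coefficient with the claimed lower bound in place of
    \<open>\<mu>\<close>; a smaller \<open>\<mu>\<close> only increases it.\<close>
  define d0 where "d0 x = (c x - (c x0 - \<delta>)) / a x" for x
  have "continuous_on UNIV d0"
    unfolding d0_def by (intro continuous_intros c_cont a_cont) simp
  moreover have "d0 x0 > 0" using \<open>\<delta> > 0\<close> a_pos by (simp add: d0_def)
  moreover have "((\<lambda>x. - B x) has_real_derivative - B' x0) (at x0)"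
    by (intro DERIV_minus B_deriv)
  moreover have "- B x0 = 0" "- B' x0 \<ge> 0"
    using True assms(1) a_pos[of x0] by (auto simp: B_def B'_at_zero divide_le_0_iff)
  ultimately obtain \<epsilon>0 where \<epsilon>0: "\<epsilon>0 > 0"
    "\<And>\<epsilon> v v' d. 0 < \<epsilon> \<Longrightarrow> \<epsilon> < \<epsilon>0 \<Longrightarrow> (\<And>x. (v has_real_derivative v' x) (at x)) \<Longrightarrow>
       (\<And>x. \<epsilon> * v' x = (v x)\<^sup>2 + - B x * v x + \<epsilon> * d x) \<Longrightarrow> (\<And>x. d x \<ge> d0 x) \<Longrightarrow> False"
    using no_small_riccati_solution[of "\<lambda>x. - B x"] by metis
  show thesis
  proof
    fix \<epsilon> \<mu> W w w'
    assume \<epsilon>: "0 < \<epsilon>" "\<epsilon> < \<epsilon>0" and R: "riccati \<epsilon> \<mu> W w w'"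
    show "c x0 - max 0 (b' x0) - \<delta> \<le> \<mu>"
    proof (rule ccontr)
      assume *: "\<not> c x0 - max 0 (b' x0) - \<delta> \<le> \<mu>"
      show False
      proof (rule \<epsilon>0(2)[OF \<epsilon>])
        show "(w has_real_derivative w' x) (at x)" for x by (rule riccatiD(3)[OF R])
        show "\<epsilon> * w' x = (w x)\<^sup>2 + - B x * w x + \<epsilon> * ((c x - \<mu>) / a x)" for x
          using riccatiD(4)[OF R, of x] by (simp add: algebra_simps power2_eq_square)
        show "(c x - \<mu>) / a x \<ge> d0 x" for x
          unfolding d0_def using * True a_pos[of x] by (intro divide_right_mono) auto
      qed
    qed
  qed (rule \<epsilon>0(1))
next
  case False
  \<comment> \<open>Substituting \<open>w = v + B\<close> produces the extra term
    \<open>- B'\<close>. At \<open>x0\<close> it cancels the \<open>b' x0\<close> of the claimed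
    bound and leaves \<open>\<delta> / a x0 > 0\<close>.\<close>
  define d0 where "d0 x = (c x - (c x0 - b' x0 - \<delta>)) / a x - B' x" for x
  have "continuous_on UNIV d0"
    unfolding d0_def by (intro continuous_intros c_cont a_cont B'_cont) simp
  moreover have "d0 x0 = \<delta> / a x0"
    using assms(1) by (simp add: d0_def B'_at_zero field_simps)
  then have "d0 x0 > 0" using \<open>\<delta> > 0\<close> a_pos by simp
  moreover have "B x0 = 0" "B' x0 \<ge> 0"
    using False assms(1) a_pos[of x0] by (auto simp: B_def B'_at_zero)
  ultimately obtain \<epsilon>0 where \<epsilon>0: "\<epsilon>0 > 0"
    "\<And>\<epsilon> v v' d. 0 < \<epsilon> \<Longrightarrow> \<epsilon> < \<epsilon>0 \<Longrightarrow> (\<And>x. (v has_real_derivative v' x) (at x)) \<Longrightarrow>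
       (\<And>x. \<epsilon> * v' x = (v x)\<^sup>2 + B x * v x + \<epsilon> * d x) \<Longrightarrow> (\<And>x. d x \<ge> d0 x) \<Longrightarrow> False"
    using no_small_riccati_solution[of B, OF B_deriv] by metis
  show thesis
  proof
    fix \<epsilon> \<mu> W w w'
    assume \<epsilon>: "0 < \<epsilon>" "\<epsilon> < \<epsilon>0" and R: "riccati \<epsilon> \<mu> W w w'"
    show "c x0 - max 0 (b' x0) - \<delta> \<le> \<mu>"
    proof (rule ccontr)
      assume *: "\<not> c x0 - max 0 (b' x0) - \<delta> \<le> \<mu>"
      show False
      proof (rule \<epsilon>0(2)[OF \<epsilon>])
        show "((\<lambda>x. w x - B x) has_real_derivative w' x - B' x) (at x)" for x
          by (intro DERIV_diff riccatiD(3)[OF R] B_deriv)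
        show "\<epsilon> * (w' x - B' x) = (w x - B x)\<^sup>2 + B x * (w x - B x)
            + \<epsilon> * ((c x - \<mu>) / a x - B' x)" for x
          using riccatiD(4)[OF R, of x]
          by (simp only: right_diff_distrib left_diff_distrib power2_eq_square)
        show "(c x - \<mu>) / a x - B' x \<ge> d0 x" for x
          unfolding d0_def using * False a_pos[of x]
          by (intro diff_right_mono divide_right_mono) auto
      qed
    qed
  qed (rule \<epsilon>0(1))
qed

text \<open>This is the maximum principle: at a minimum of \<open>W\<close>, that is, a maximum of
  the eigenfunction, \<open>w = 0\<close> and \<open>w' \<ge> 0\<close>, while the equation reduces
  to \<open>w' = (c - \<mu>) / a\<close>.\<close>

lemma eigenvalue_upper_bound:
  assumes "\<epsilon> > 0" and R: "riccati \<epsilon> \<mu> W w w'"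
  obtains x where "\<mu> \<le> c x"
proof -
  have "continuous_on UNIV (\<lambda>x. - W x)"
    by (intro continuous_intros DERIV_continuous_on[OF riccatiD(2)[OF R]])
  then obtain m where m: "\<And>x. W m \<le> W x"
    using periodic_attains_sup[of "\<lambda>x. - W x"] riccatiD(1)[OF R] by auto
  have w0: "w m = 0"
    by (rule DERIV_local_min[OF riccatiD(2)[OF R], of 1]) (auto simp: m)
  have "w' m \<ge> 0"
  proof (rule ccontr)
    assume "\<not> w' m \<ge> 0"
    then obtain d where d: "d > 0" "\<And>h. 0 < h \<Longrightarrow> h < d \<Longrightarrow> w m > w (m + h)"
      using DERIV_neg_dec_right[OF riccatiD(3)[OF R], of m] by auto
    obtain z where z: "m < z" "z < m + d / 2" "W (m + d / 2) - W m = d / 2 * w z"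
      using MVT2[of m "m + d / 2" W w] riccatiD(2)[OF R] d(1) by auto
    have "w z < 0" using d(2)[of "z - m"] z w0 by simp
    then have "d / 2 * w z < 0" using d(1) by (simp add: mult_pos_neg)
    then have "W (m + d / 2) - W m < 0" using z(3) by linarith
    then show False using m[of "m + d / 2"] by simp
  qed
  moreover have "w' m = (c m - \<mu>) / a m"
  proof -
    have "\<epsilon> * w' m = \<epsilon> * ((c m - \<mu>) / a m)"
      using riccatiD(4)[OF R, of m] unfolding w0 by simp
    then show ?thesis using \<open>\<epsilon> > 0\<close> by (metis less_irrefl mult_left_cancel)
  qed
  ultimately have "\<mu> \<le> c m" using a_pos[of m] by (simp add: zero_le_divide_iff)
  then show thesis by (rule that)
qed

text \<open>
  At an extremum of the distance from \<open>w\<close> to a root of \<open>y (y - B) = \<eta>\<close>, the derivative of \<open>w\<close>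
  is bounded independently of \<open>\<epsilon>\<close>, so that \<open>w\<close> cannot lie beyond this root.
\<close>

lemma residual_bound:
  assumes "\<eta> > 0"
  obtains \<epsilon>0 where "\<epsilon>0 > 0"
    and "\<And>\<epsilon> \<mu> W w w' x. 0 < \<epsilon> \<Longrightarrow> \<epsilon> < \<epsilon>0 \<Longrightarrow> riccati \<epsilon> \<mu> W w w' \<Longrightarrow>
           (\<And>x. \<bar>(c x - \<mu>) / a x\<bar> \<le> \<Lambda>) \<Longrightarrow> w x * (w x - B x) \<le> \<eta>"
proof -
  obtain K where K: "K > 0" "\<And>x. \<bar>B' x\<bar> \<le> K"
    using periodic_bounded[OF B'_periodic B'_cont] by blast
  \<comment> \<open>\<open>(B - S) / 2\<close> and \<open>(B + S) / 2\<close> are the roots of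
    \<open>y * (y - B) = \<eta>\<close>; since \<open>\<eta> > 0\<close>, \<open>S\<close> never
    vanishes and is differentiable.\<close>
  define S where "S x = sqrt ((B x)\<^sup>2 + 4 * \<eta>)" for x
  have S: "S x > 0" "\<bar>B x\<bar> \<le> S x" "(S x)\<^sup>2 = (B x)\<^sup>2 + 4 * \<eta>" for x
  proof -
    show "S x > 0" unfolding S_def using assms by (simp add: add_nonneg_pos)
    show "\<bar>B x\<bar> \<le> S x" unfolding S_def using assms by (intro real_le_rsqrt) simp
    show "(S x)\<^sup>2 = (B x)\<^sup>2 + 4 * \<eta>" unfolding S_def using assms by simp
  qed
  have S': "(S has_real_derivative B x * B' x / S x) (at x)" for x
  proof -
    have B2: "((\<lambda>x. (B x)\<^sup>2 + 4 * \<eta>) has_real_derivative 2 * B x * B' x) (at x)"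
      by (auto intro!: derivative_eq_intros B_deriv)
    have "(B x)\<^sup>2 + 4 * \<eta> > 0" using assms by (simp add: add_nonneg_pos)
    then have "(S has_real_derivative inverse (sqrt ((B x)\<^sup>2 + 4 * \<eta>)) / 2 * (2 * B x * B' x)) (at x)"
      unfolding S_def by (rule DERIV_chain2[OF DERIV_real_sqrt B2])
    moreover have "inverse (sqrt ((B x)\<^sup>2 + 4 * \<eta>)) / 2 * (2 * B x * B' x) = B x * B' x / S x"
      by (simp add: S_def inverse_eq_divide mult_ac)
    ultimately show ?thesis by metis
  qed
  show thesis
  proof
    show "\<eta> / (K + \<bar>\<Lambda>\<bar>) > 0" using assms K by (simp add: add_pos_nonneg)
    fix \<epsilon> \<mu> W w w' x
    assume \<epsilon>: "0 < \<epsilon>" "\<epsilon> < \<eta> / (K + \<bar>\<Lambda>\<bar>)" and R: "riccati \<epsilon> \<mu> W w w'"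
      and \<Lambda>: "\<And>x. \<bar>(c x - \<mu>) / a x\<bar> \<le> \<Lambda>"
    have \<epsilon>': "\<epsilon> * (K + \<Lambda>) < \<eta>"
    proof -
      have "\<Lambda> \<ge> 0" using \<Lambda>[of 0] by linarith
      then show ?thesis using \<epsilon> K by (simp add: pos_less_divide_eq add_pos_nonneg)
    qed
    \<comment> \<open>For \<open>s = 1\<close> this places \<open>w\<close> below the larger root,
      for \<open>s = -1\<close> above the smaller one.\<close>
    have root: "s * (w x - (B x + s * S x) / 2) \<le> 0" if s: "s = 1 \<or> s = -1" for s x
    proof -
      define f where "f x = s * (w x - (B x + s * S x) / 2)" for x
      define P' where "P' x = (B' x + s * (B x * B' x / S x)) / 2" for x
      have f': "(f has_real_derivative s * (w' x - P' x)) (at x)" for x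
        unfolding f_def P'_def
        by (intro DERIV_cmult DERIV_diff riccatiD(3)[OF R] DERIV_cdivide DERIV_add B_deriv S')
      have "f (x + 1) = f x" for x
        by (simp add: f_def riccatiD(5)[OF R] B_periodic S_def)
      then obtain m where m: "\<And>x. f x \<le> f m"
        using periodic_attains_sup[OF _ DERIV_continuous_on[OF f']] by metis
      have "s * (w' m - P' m) = 0"
        by (rule DERIV_local_max[OF f', of 1]) (auto simp: m)
      then have "w' m = P' m" using s by auto
      have "f m \<le> 0"
      proof (rule ccontr)
        assume "\<not> f m \<le> 0"
        then have t: "f m > 0" by simp
        have wm: "w m - B m / 2 = s * (S m / 2 + f m)"
          using s by (auto simp: f_def field_simps)
        have "(w m - B m / 2)\<^sup>2 = (S m / 2 + f m)\<^sup>2"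
          unfolding wm power_mult_distrib using s by auto
        also have "\<dots> > (S m / 2)\<^sup>2"
          using t S(1)[of m] by (intro power_strict_mono) auto
        finally have "w m * (w m - B m) > \<eta>"
          using S(3)[of m] by (simp add: power2_eq_square field_simps)
        then have "\<epsilon> * w' m > \<eta> + \<epsilon> * ((c m - \<mu>) / a m)"
          using riccatiD(4)[OF R, of m] by linarith
        moreover have "\<epsilon> * ((c m - \<mu>) / a m) \<ge> \<epsilon> * (- \<Lambda>)"
          using \<Lambda>[of m] \<epsilon>(1) by (intro mult_left_mono) linarith+
        moreover have "\<epsilon> * w' m \<le> \<epsilon> * K"
        proof -
          have average: "\<bar>(u + s * v) / 2\<bar> \<le> \<bar>u\<bar>" if "\<bar>v\<bar> \<le> \<bar>u\<bar> * 1" for u v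
            using s that by auto
          have "\<bar>B m * B' m / S m\<bar> = \<bar>B' m\<bar> * (\<bar>B m\<bar> / S m)"
            using S(1)[of m] by (simp add: abs_mult)
          also have "\<dots> \<le> \<bar>B' m\<bar> * 1"
            using S(1,2)[of m] by (intro mult_left_mono) auto
          finally have "\<bar>P' m\<bar> \<le> \<bar>B' m\<bar>"
            unfolding P'_def by (rule average)
          then have "P' m \<le> K" using K(2)[of m] by linarith
          then show ?thesis using \<open>w' m = P' m\<close> \<epsilon>(1) by simp
        qed
        ultimately show False using \<epsilon>' by (simp add: distrib_left)
      qed
      then show ?thesis using m[of x] by (simp add: f_def)
    qed
    have "\<bar>w x - B x / 2\<bar> \<le> S x / 2"
      using root[of 1 x] root[of "-1" x] by (simp add: abs_le_iff field_simps)
    then have "(w x - B x / 2)\<^sup>2 \<le> (S x / 2)\<^sup>2"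
      using abs_le_square_iff[of "w x - B x / 2" "S x / 2"] S(1)[of x] by simp
    then show "w x * (w x - B x) \<le> \<eta>"
      using S(3)[of x] by (simp add: power2_eq_square field_simps)
  qed
qed

text \<open>On \<open>p = \<theta> * B\<close> the residual is \<open>- h\<close> with
  \<open>h = \<theta> * (1 - \<theta>) * B\<^sup>2\<close>, so
  \<open>\<epsilon> * (w' - p') \<le> \<epsilon> * g - h\<close> there. This is negative for small
  \<open>\<epsilon>\<close>: \<open>h\<close> vanishes only at zeros of \<open>b\<close>, where
  \<open>g < 0\<close> by the gap hypothesis, as \<open>\<theta> * b'\<close> is almost as large as
  \<open>max 0 b'\<close>. Hence \<open>w\<close> can cross \<open>p\<close> only downwards.\<close>

lemma switching_barrier:
  assumes "l \<le> r" and gap: "\<And>x. x \<in> {l..r} \<Longrightarrow> b x = 0 \<Longrightarrow> c x - max 0 (b' x) < M"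
  obtains \<theta> \<sigma> \<delta> \<epsilon>0 where "\<sigma> > 0" "\<delta> > 0" "\<epsilon>0 > 0"
    and "\<And>x. x \<in> {l..r} \<Longrightarrow> \<sigma> \<le> \<theta> x \<and> \<theta> x \<le> 1 - \<sigma>"
    and "\<And>\<epsilon> \<mu> W w w' y z. 0 < \<epsilon> \<Longrightarrow> \<epsilon> < \<epsilon>0 \<Longrightarrow> riccati \<epsilon> \<mu> W w w' \<Longrightarrow> M - \<delta> \<le> \<mu> \<Longrightarrow>
           l \<le> y \<Longrightarrow> y \<le> z \<Longrightarrow> z \<le> r \<Longrightarrow> w y < \<theta> y * B y \<Longrightarrow> w z < \<theta> z * B z"
proof -
  obtain \<delta> where \<delta>: "\<delta> > 0" "\<And>x. x \<in> {l..r} \<Longrightarrow> b x = 0 \<Longrightarrow> c x - max 0 (b' x) + 2 * \<delta> < M"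
  proof -
    \<comment> \<open>With a constant \<open>g\<close>, the domination lemma turns the pointwise gap
      into a uniform one on the compact zero set. Of the \<open>2 * \<delta>\<close>, one
      \<open>\<delta>\<close> allows for an eigenvalue as low as \<open>M - \<delta>\<close>, the
      other for the error of \<open>\<theta>\<close>.\<close>
    have "\<exists>\<epsilon>0>0. \<forall>\<epsilon> x. 0 < \<epsilon> \<longrightarrow> \<epsilon> < \<epsilon>0 \<longrightarrow> x \<in> {x \<in> {l..r}. b x = 0} \<longrightarrow>
        \<epsilon> * 2 < M - (c x - max 0 (b' x))"
    proof (rule small_parameter_domination[where K = "{x \<in> {l..r}. b x = 0}"
          and g = "\<lambda>_. 2" and h = "\<lambda>x. M - (c x - max 0 (b' x))"])
      have "closed ({l..r} \<inter> b -` {0})"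
        using continuous_on_subset[OF b_cont] by (intro continuous_closed_preimage) auto
      moreover have "{x \<in> {l..r}. b x = 0} = {l..r} \<inter> b -` {0}" by auto
      ultimately show "compact {x \<in> {l..r}. b x = 0}"
        unfolding compact_eq_bounded_closed
        by (metis bounded_Int bounded_closed_interval)
      show "continuous_on {x \<in> {l..r}. b x = 0} (\<lambda>x. M - (c x - max 0 (b' x)))"
        by (intro continuous_intros continuous_on_subset[OF c_cont]
            continuous_on_subset[OF b'_cont]) auto
    qed (use gap in \<open>force+\<close>)
    then obtain \<epsilon>0 where \<epsilon>0: "\<epsilon>0 > 0" "\<And>\<epsilon> x. 0 < \<epsilon> \<Longrightarrow> \<epsilon> < \<epsilon>0 \<Longrightarrow> x \<in> {l..r} \<Longrightarrow> b x = 0 \<Longrightarrow>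
        \<epsilon> * 2 < M - (c x - max 0 (b' x))" by auto
    show thesis
      using that[of "\<epsilon>0 / 2"] \<epsilon>0(1) \<epsilon>0(2)[of "\<epsilon>0 / 2"] by force
  qed
  obtain \<theta> \<theta>' where \<theta>': "\<And>x. (\<theta> has_real_derivative \<theta>' x) (at x)" "continuous_on UNIV \<theta>'"
    and \<theta>01: "\<And>x. 0 < \<theta> x" "\<And>x. \<theta> x < 1"
    and \<theta>: "\<And>x. x \<in> {l..r} \<Longrightarrow> \<theta> x * b' x \<ge> max 0 (b' x) - \<delta>"
    using smooth_positive_part[OF b_deriv b'_cont \<delta>(1), where l = l and r = r] by metis
  have \<theta>_cont: "continuous_on UNIV \<theta>"
    by (rule DERIV_continuous_on[OF \<theta>'(1)])
  \<comment> \<open>The minimum of this function becomes \<open>\<sigma>\<close>, the relative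
    distance of the barrier from the roots \<open>0\<close> and \<open>B\<close>.\<close>
  have "continuous_on {l..r} (\<lambda>x. min (\<theta> x) (1 - \<theta> x))"
    by (intro continuous_intros continuous_on_subset[OF \<theta>_cont]) auto
  then obtain m where m: "\<And>x. x \<in> {l..r} \<Longrightarrow> min (\<theta> m) (1 - \<theta> m) \<le> min (\<theta> x) (1 - \<theta> x)"
    using continuous_attains_inf[of "{l..r}" "\<lambda>x. min (\<theta> x) (1 - \<theta> x)"] \<open>l \<le> r\<close>
    by (metis atLeastAtMost_iff compact_Icc empty_iff order_refl)
  define p' where "p' x = \<theta>' x * B x + B' x * \<theta> x" for x
  have p': "((\<lambda>x. \<theta> x * B x) has_real_derivative p' x) (at x)" for x
    unfolding p'_def by (rule DERIV_mult[OF \<theta>'(1) B_deriv])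
  define g where "g x = (c x - (M - \<delta>)) / a x - p' x" for x
  define h where "h x = \<theta> x * (1 - \<theta> x) * (B x)\<^sup>2" for x
  have sub: "continuous_on UNIV f \<Longrightarrow> continuous_on {l..r} f" for f :: "real \<Rightarrow> real"
    by (erule continuous_on_subset) simp
  obtain \<epsilon>0 where \<epsilon>0: "\<epsilon>0 > 0"
    "\<And>\<epsilon> x. 0 < \<epsilon> \<Longrightarrow> \<epsilon> < \<epsilon>0 \<Longrightarrow> x \<in> {l..r} \<Longrightarrow> \<epsilon> * g x < h x"
  proof (rule small_parameter_domination[where K = "{l..r}" and g = g and h = h])
    show "continuous_on {l..r} g" "continuous_on {l..r} h"
      unfolding g_def h_def p'_def
      by (intro sub continuous_intros c_cont a_cont B_cont B'_cont \<theta>_cont \<theta>'(2); simp)+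
    fix x assume x: "x \<in> {l..r}"
    have pos: "\<theta> x * (1 - \<theta> x) > 0" using \<theta>01[of x] by simp
    then show "h x \<ge> 0" by (simp add: h_def)
    assume "h x = 0"
    then have "b x = 0" using pos by (auto simp: h_def B_def)
    then have "g x = (c x - (M - \<delta>) - \<theta> x * b' x) / a x"
      by (simp add: g_def p'_def B_def B'_at_zero diff_divide_distrib mult.commute)
    moreover have "c x - (M - \<delta>) - \<theta> x * b' x < 0"
      using \<delta>(2)[OF x \<open>b x = 0\<close>] \<theta>[OF x] by linarith
    ultimately show "g x < 0" using a_pos[of x] by (simp add: divide_neg_pos)
  qed (rule compact_Icc, blast intro: that)
  show thesis
  proof
    show "min (\<theta> m) (1 - \<theta> m) > 0" using \<theta>01[of m] by simp
    show "\<delta> > 0" "\<epsilon>0 > 0" by fact+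
    show "min (\<theta> m) (1 - \<theta> m) \<le> \<theta> x \<and> \<theta> x \<le> 1 - min (\<theta> m) (1 - \<theta> m)"
      if "x \<in> {l..r}" for x
      using m[OF that] by linarith
    fix \<epsilon> \<mu> W w w' y z
    assume \<epsilon>: "0 < \<epsilon>" "\<epsilon> < \<epsilon>0" and R: "riccati \<epsilon> \<mu> W w w'" and \<mu>: "M - \<delta> \<le> \<mu>"
      and yz: "l \<le> y" "y \<le> z" "z \<le> r" and "w y < \<theta> y * B y"
    have "w z - \<theta> z * B z < 0"
    proof (rule stays_negative[where D = "\<lambda>x. w x - \<theta> x * B x" and D' = "\<lambda>x. w' x - p' x"])
      show "((\<lambda>x. w x - \<theta> x * B x) has_real_derivative w' x - p' x) (at x)" for x
        by (intro DERIV_diff riccatiD(3)[OF R] p')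
      fix x assume x: "x \<in> {y..z}" and "w x - \<theta> x * B x = 0"
      then have w: "w x = \<theta> x * B x" by simp
      have "(c x - \<mu>) / a x \<le> (c x - (M - \<delta>)) / a x"
        using \<mu> a_pos[of x] by (intro divide_right_mono) auto
      then have "\<epsilon> * ((c x - \<mu>) / a x) \<le> \<epsilon> * ((c x - (M - \<delta>)) / a x)"
        using \<epsilon> by (intro mult_left_mono) auto
      moreover have "w x * (w x - B x) = - h x"
        by (simp add: w h_def power2_eq_square algebra_simps)
      moreover have "\<epsilon> * g x < h x" using \<epsilon>0(2)[OF \<epsilon>, of x] x yz by simp
      ultimately have "\<epsilon> * (w' x - p' x) < 0"
        using riccatiD(4)[OF R, of x] by (simp add: g_def right_diff_distrib)
      then show "w' x - p' x < 0" using \<epsilon>(1) by (simp add: mult_less_0_iff)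
    qed (use yz \<open>w y < \<theta> y * B y\<close> in auto)
    then show "w z < \<theta> z * B z" by simp
  qed
qed

text \<open>
  To the left of the switching point \<open>T\<close> the solution \<open>w\<close> follows the root \<open>max 0 B\<close>, to its right
  the root \<open>- max 0 (- B)\<close>; since \<open>W\<close> is periodic, \<open>T\<close> has to be the point where the two
  resulting profiles meet, so that \<open>W\<close> is their minimum.
\<close>

lemma riccati_convergence:
  fixes P N :: "real \<Rightarrow> real"
  assumes P: "\<And>x. (P has_real_derivative max 0 (B x)) (at x)"
    and N: "\<And>x. (N has_real_derivative max 0 (- B x)) (at x)"
    and zero: "b x0 = 0"
    and maximal: "\<And>x. x0 < x \<Longrightarrow> x < x0 + 1 \<Longrightarrow> b x = 0 \<Longrightarrow>
      c x - max 0 (b' x) < c x0 - max 0 (b' x0)"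
    and "\<kappa> > 0"
  obtains \<epsilon>0 where "\<epsilon>0 > 0"
    and "\<And>\<epsilon> \<mu> W w w' x. 0 < \<epsilon> \<Longrightarrow> \<epsilon> < \<epsilon>0 \<Longrightarrow> riccati \<epsilon> \<mu> W w w' \<Longrightarrow> x \<in> {x0..x0 + 1} \<Longrightarrow>
           \<bar>W x - W x0 - min (P x - P x0) (N (x0 + 1) - N x)\<bar> \<le> \<kappa>"
proof -
  define M where "M = c x0 - max 0 (b' x0)"
  obtain Kc where Kc: "Kc > 0" "\<And>x. \<bar>c x\<bar> \<le> Kc"
    using periodic_bounded[OF c_periodic c_cont] by blast
  have "continuous_on UNIV (\<lambda>x. 1 / a x)" by (intro continuous_intros a_cont) simp
  then obtain Ka where Ka: "Ka > 0" "\<And>x. \<bar>1 / a x\<bar> \<le> Ka"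
    using periodic_bounded[of "\<lambda>x. 1 / a x"] a_periodic by auto
  obtain KB where KB: "KB > 0" "\<And>x. \<bar>B x\<bar> \<le> KB"
    using periodic_bounded[OF B_periodic B_cont] by blast
  define K where "K = KB + 1"
  have K: "K > 0" "\<And>x. \<bar>B x\<bar> \<le> K - 1" using KB by (auto simp: K_def)
  \<comment> \<open>\<open>\<bar>M\<bar> + 1 + Kc\<close> will bound
    \<open>\<bar>\<mu>\<bar>\<close>: from below \<open>\<mu>\<close> loses at most 1 against
    \<open>M\<close>, from above it is bounded by a value of \<open>c\<close>.\<close>
  define \<Lambda> where "\<Lambda> = (Kc + (\<bar>M\<bar> + 1 + Kc)) * Ka"
  \<comment> \<open>The final estimate adds three errors of size \<open>\<kappa>'\<close>: one at
    \<open>x\<close> and one at \<open>T\<close> from each side.\<close>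
  define \<kappa>' where "\<kappa>' = \<kappa> / 3"
  have \<kappa>': "\<kappa>' > 0" using \<open>\<kappa> > 0\<close> by (simp add: \<kappa>'_def)
  \<comment> \<open>The gap closes at \<open>x0\<close> and \<open>x0 + 1\<close>, so there is no
    barrier there. Layers of width \<open>\<rho>\<close> are cut off; as \<open>w\<close> and
    \<open>B\<close> are bounded by \<open>K\<close>, each costs at most
    \<open>2 * K * \<rho>\<close>.\<close>
  define \<rho> where "\<rho> = min (1 / 4) (\<kappa>' / (4 * K))"
  have \<rho>: "\<rho> > 0" "\<rho> \<le> 1 / 4" "2 * K * \<rho> \<le> \<kappa>' / 2"
  proof -
    show "\<rho> > 0" "\<rho> \<le> 1 / 4" using \<kappa>' K(1) by (auto simp: \<rho>_def)
    have "2 * K * \<rho> \<le> 2 * K * (\<kappa>' / (4 * K))"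
      using K(1) by (intro mult_left_mono) (auto simp: \<rho>_def)
    then show "2 * K * \<rho> \<le> \<kappa>' / 2" using K(1) by simp
  qed
  define l where "l = x0 + \<rho>"
  define r where "r = x0 + 1 - \<rho>"
  have lr: "l \<le> r" using \<rho> by (simp add: l_def r_def)
  have "c x - max 0 (b' x) < M" if "x \<in> {l..r}" "b x = 0" for x
    using maximal[of x] that \<rho>(1) by (auto simp: l_def r_def M_def)
  then obtain \<theta> \<sigma> \<delta> \<epsilon>1 where \<sigma>: "\<sigma> > 0" and \<delta>: "\<delta> > 0" and \<epsilon>1: "\<epsilon>1 > 0"
    and \<theta>: "\<And>x. x \<in> {l..r} \<Longrightarrow> \<sigma> \<le> \<theta> x \<and> \<theta> x \<le> 1 - \<sigma>"
    and stay: "\<And>\<epsilon> \<mu> W w w' y z. 0 < \<epsilon> \<Longrightarrow> \<epsilon> < \<epsilon>1 \<Longrightarrow> riccati \<epsilon> \<mu> W w w' \<Longrightarrow> M - \<delta> \<le> \<mu> \<Longrightarrow>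
       l \<le> y \<Longrightarrow> y \<le> z \<Longrightarrow> z \<le> r \<Longrightarrow> w y < \<theta> y * B y \<Longrightarrow> w z < \<theta> z * B z"
    by (rule switching_barrier[OF lr, of M]) blast+
  obtain \<epsilon>2 where \<epsilon>2: "\<epsilon>2 > 0" and lower: "\<And>\<epsilon> \<mu> W w w'. 0 < \<epsilon> \<Longrightarrow> \<epsilon> < \<epsilon>2 \<Longrightarrow>
       riccati \<epsilon> \<mu> W w w' \<Longrightarrow> M - min 1 \<delta> \<le> \<mu>"
    using eigenvalue_lower_bound[OF zero, of "min 1 \<delta>"] \<delta> unfolding M_def
    by (metis min_less_iff_conj zero_less_one)
  \<comment> \<open>\<open>\<tau>\<close>, \<open>\<eta>\<close> and \<open>\<epsilon>4\<close> are
    chosen to contribute at most \<open>\<kappa>' / 6\<close> each, so that the error between the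
    layers is at most \<open>\<kappa>' / 2\<close>.\<close>
  define \<tau> where "\<tau> = \<kappa>' / 6"
  define \<eta> where "\<eta> = min 1 (\<sigma> * \<tau> * \<kappa>' / 12)"
  have \<tau>: "\<tau> > 0" using \<kappa>' by (simp add: \<tau>_def)
  have \<eta>: "\<eta> > 0" "\<eta> \<le> 1" "2 * \<eta> / (\<sigma> * \<tau>) \<le> \<kappa>' / 6"
  proof -
    show "\<eta> > 0" "\<eta> \<le> 1" using \<sigma> \<tau> \<kappa>' by (auto simp: \<eta>_def)
    have "2 * \<eta> / (\<sigma> * \<tau>) \<le> 2 * (\<sigma> * \<tau> * \<kappa>' / 12) / (\<sigma> * \<tau>)"
      using \<sigma> \<tau> by (intro divide_right_mono mult_left_mono) (auto simp: \<eta>_def)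
    then show "2 * \<eta> / (\<sigma> * \<tau>) \<le> \<kappa>' / 6" using \<sigma> \<tau> by simp
  qed
  obtain \<epsilon>3 where \<epsilon>3: "\<epsilon>3 > 0" and residual: "\<And>\<epsilon> \<mu> W w w' x. 0 < \<epsilon> \<Longrightarrow> \<epsilon> < \<epsilon>3 \<Longrightarrow>
      riccati \<epsilon> \<mu> W w w' \<Longrightarrow> (\<And>x. \<bar>(c x - \<mu>) / a x\<bar> \<le> \<Lambda>) \<Longrightarrow> w x * (w x - B x) \<le> \<eta>"
    using residual_bound[OF \<eta>(1), of \<Lambda>] by metis
  have \<Lambda>0: "\<Lambda> \<ge> 0" using Kc Ka by (simp add: \<Lambda>_def)
  define \<epsilon>4 where "\<epsilon>4 = \<sigma> * \<tau> * \<kappa>' / (6 * (\<Lambda> + 2 * K))"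
  have \<epsilon>4: "\<epsilon>4 > 0" using \<sigma> \<tau> \<kappa>' \<Lambda>0 K(1) by (simp add: \<epsilon>4_def add_nonneg_pos)
  show thesis
  proof (rule that[of "min (min \<epsilon>1 \<epsilon>2) (min \<epsilon>3 \<epsilon>4)"])
    show "min (min \<epsilon>1 \<epsilon>2) (min \<epsilon>3 \<epsilon>4) > 0" using \<epsilon>1 \<epsilon>2 \<epsilon>3 \<epsilon>4 by simp
    fix \<epsilon> \<mu> W w w' x
    assume \<epsilon>: "0 < \<epsilon>" "\<epsilon> < min (min \<epsilon>1 \<epsilon>2) (min \<epsilon>3 \<epsilon>4)"
      and R: "riccati \<epsilon> \<mu> W w w'" and x: "x \<in> {x0..x0 + 1}"
    have \<mu>_lower: "M - min 1 \<delta> \<le> \<mu>" using lower[OF \<epsilon>(1) _ R] \<epsilon>(2) by simp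
    obtain y where "\<mu> \<le> c y" using eigenvalue_upper_bound[OF \<epsilon>(1) R] .
    then have "\<mu> \<le> Kc" using Kc(2)[of y] by linarith
    then have \<mu>: "\<bar>\<mu>\<bar> \<le> \<bar>M\<bar> + 1 + Kc" using \<mu>_lower Kc(1) by linarith
    have \<Lambda>: "\<bar>(c x - \<mu>) / a x\<bar> \<le> \<Lambda>" for x
    proof -
      have "\<bar>c x - \<mu>\<bar> * \<bar>1 / a x\<bar> \<le> (Kc + (\<bar>M\<bar> + 1 + Kc)) * Ka"
        using Kc(2)[of x] \<mu> Kc(1) by (intro mult_mono Ka(2)) linarith+
      then show ?thesis by (simp add: \<Lambda>_def abs_mult)
    qed
    have res: "w x * (w x - B x) \<le> \<eta>" for x
      using residual[OF \<epsilon>(1) _ R \<Lambda>] \<epsilon>(2) by simp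
    \<comment> \<open>The residual bound confines \<open>w\<close>: if \<open>\<bar>w\<bar>\<close>
      exceeded \<open>K = KB + 1\<close>, then \<open>w * (w - B)\<close> would exceed
      \<open>1 \<ge> \<eta>\<close>.\<close>
    have wK: "\<bar>w x\<bar> \<le> K" for x
    proof (rule ccontr)
      assume "\<not> \<bar>w x\<bar> \<le> K"
      then have *: "\<bar>w x\<bar> > K" "\<bar>w x\<bar> - \<bar>B x\<bar> > 1" using K(2)[of x] by linarith+
      have "1 < \<bar>w x\<bar>" using *(2) by linarith
      then have "1 * 1 < \<bar>w x\<bar> * (\<bar>w x\<bar> - \<bar>B x\<bar>)" using *(2) by (intro mult_strict_mono) auto
      also have "\<dots> \<le> w x * (w x - B x)"
        using abs_ge_self[of "w x * B x"]
        by (simp add: right_diff_distrib abs_mult flip: power2_eq_square)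
      finally show False using res[of x] \<eta>(2) by linarith
    qed
    have stay': "w z < \<theta> z * B z" if "l \<le> y" "y \<le> z" "z \<le> r" "w y < \<theta> y * B y" for y z
      by (rule stay[OF \<epsilon>(1) _ R _ that]) (use \<epsilon>(2) \<mu>_lower in auto)
    obtain T where T: "l \<le> T" "T \<le> r"
      and left: "\<And>x. l \<le> x \<Longrightarrow> x < T \<Longrightarrow> w x \<ge> \<theta> x * B x"
      and right: "\<And>x. T < x \<Longrightarrow> x \<le> r \<Longrightarrow> w x \<le> \<theta> x * B x"
      using switching_point[OF lr, of w "\<lambda>x. \<theta> x * B x"] stay' by metis
    \<comment> \<open>With these constants the Riccati equation turns the bound of
      \<open>error_bound_from_residual\<close> into \<open>q - k * w'\<close>, where only
      \<open>q\<close> has to be integrated as an error.\<close>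
    define k where "k = \<epsilon> / (\<sigma> * \<tau>)"
    define q where "q = \<tau> + (2 * \<eta> + \<epsilon> * \<Lambda>) / (\<sigma> * \<tau>)"
    have k: "k \<ge> 0" using \<epsilon> \<sigma> \<tau> by (simp add: k_def)
    have small: "q * 1 + k * (2 * K) \<le> \<kappa>' / 2" and q0: "q \<ge> 0"
    proof -
      have "\<epsilon> * (\<Lambda> + 2 * K) \<le> \<sigma> * \<tau> * \<kappa>' / 6"
      proof -
        have pos: "6 * (\<Lambda> + 2 * K) > 0" using \<Lambda>0 K(1) by simp
        have "\<epsilon> < \<epsilon>4" using \<epsilon>(2) by simp
        then have "\<epsilon> * (6 * (\<Lambda> + 2 * K)) < \<sigma> * \<tau> * \<kappa>'"
          unfolding \<epsilon>4_def pos_less_divide_eq[OF pos] .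
        then show ?thesis by (simp add: algebra_simps)
      qed
      then have "\<epsilon> * (\<Lambda> + 2 * K) / (\<sigma> * \<tau>) \<le> \<sigma> * \<tau> * \<kappa>' / 6 / (\<sigma> * \<tau>)"
        using \<sigma> \<tau> by (intro divide_right_mono) auto
      moreover have "\<sigma> * \<tau> * \<kappa>' / 6 / (\<sigma> * \<tau>) = \<kappa>' / 6" using \<sigma> \<tau> by simp
      moreover have "q * 1 + k * (2 * K) = \<tau> + 2 * \<eta> / (\<sigma> * \<tau>) + \<epsilon> * (\<Lambda> + 2 * K) / (\<sigma> * \<tau>)"
        by (simp add: q_def k_def add_divide_distrib distrib_left)
      ultimately show "q * 1 + k * (2 * K) \<le> \<kappa>' / 2" using \<eta>(3) by (simp add: \<tau>_def)
      show "q \<ge> 0" using \<epsilon> \<sigma> \<tau> \<eta> \<Lambda>0 by (simp add: q_def)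
    qed
    have residual_deriv: "\<tau> + (2 * max 0 \<eta> - w x * (w x - B x)) / (\<sigma> * \<tau>) \<le> q - k * w' x" for x
    proof -
      have "\<epsilon> * ((c x - \<mu>) / a x) \<le> \<epsilon> * \<Lambda>"
        using \<Lambda>[of x] \<epsilon>(1) by (intro mult_left_mono) linarith+
      then have "2 * max 0 \<eta> - w x * (w x - B x) \<le> 2 * \<eta> + \<epsilon> * \<Lambda> - \<epsilon> * w' x"
        using riccatiD(4)[OF R, of x] \<eta>(1) by (simp add: max_def)
      then have "(2 * max 0 \<eta> - w x * (w x - B x)) / (\<sigma> * \<tau>)
          \<le> (2 * \<eta> + \<epsilon> * \<Lambda> - \<epsilon> * w' x) / (\<sigma> * \<tau>)"
        using \<sigma> \<tau> by (intro divide_right_mono) auto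
      then show ?thesis by (simp add: q_def k_def diff_divide_distrib)
    qed
    have wdiff: "- k * (w m - w n) \<le> k * (2 * K)" for m n
    proof -
      have "k * (w n - w m) \<le> k * (2 * K)"
        using wK[of m] wK[of n] k by (intro mult_left_mono) auto
      then show ?thesis by (simp add: algebra_simps)
    qed
    have qlen: "q * (n - m) \<le> q * 1" if "m \<ge> x0" "n \<le> x0 + 1" for m n
      using q0 that by (intro mult_left_mono) auto
    have DP: "((\<lambda>x. W x - P x) has_real_derivative w x - max 0 (B x)) (at x)" for x
      by (intro DERIV_diff riccatiD(2)[OF R] P)
    have DN: "((\<lambda>x. W x + N x) has_real_derivative w x + max 0 (- B x)) (at x)" for x
      by (intro DERIV_add riccatiD(2)[OF R] N)
    \<comment> \<open>\<open>y = min x l\<close> separates the layer \<open>[x0, y]\<close>, treated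
      with the crude bound \<open>2 * K\<close>, from \<open>[y, x]\<close>, where the barrier keeps
      \<open>w\<close> on the side of \<open>max 0 B\<close>. Each part costs at most
      \<open>\<kappa>' / 2\<close>.\<close>
    have leftP: "\<bar>(W x - P x) - (W x0 - P x0)\<bar> \<le> \<kappa>'" if xT: "x0 \<le> x" "x \<le> T" for x
    proof -
      define y where "y = min x l"
      have "\<bar>(W y - P y) - (W x0 - P x0)\<bar> \<le> 2 * K * (y - x0) - 0 * (w y - w x0)"
      proof (rule derivative_error_integrated[OF _ DP riccatiD(3)[OF R]])
        show "\<bar>w z - max 0 (B z)\<bar> \<le> 2 * K - 0 * w' z" for z
          using wK[of z] K(2)[of z] by (simp add: abs_le_iff max_def)
      qed (use xT \<rho> in \<open>auto simp: y_def l_def\<close>)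
      also have "\<dots> \<le> 2 * K * \<rho>"
        using K(1) by (auto simp: y_def l_def)
      finally have 1: "\<bar>(W y - P y) - (W x0 - P x0)\<bar> \<le> \<kappa>' / 2" using \<rho>(3) by linarith
      have "\<bar>(W x - P x) - (W y - P y)\<bar> \<le> q * (x - y) - k * (w x - w y)"
      proof (rule derivative_error_integrated[OF _ DP riccatiD(3)[OF R]])
        fix z assume z: "y < z" "z < x"
        then have z': "z \<in> {l..r}" "l \<le> z" "z < T" using xT T by (auto simp: y_def)
        show "\<bar>w z - max 0 (B z)\<bar> \<le> q - k * w' z"
          using error_bound_from_residual[OF \<sigma> _ _ left[OF z'(2,3)] res \<tau>] \<theta>[OF z'(1)]
            residual_deriv[of z] by (meson order_trans)
      qed (simp add: y_def)
      also have "\<dots> \<le> \<kappa>' / 2"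
      proof -
        have "y \<ge> x0" "x \<le> x0 + 1" using xT T \<rho> by (auto simp: y_def l_def r_def)
        then show ?thesis using wdiff[of x y] qlen[of y x] small by linarith
      qed
      finally show ?thesis using 1 by linarith
    qed
    have rightN: "\<bar>(W (x0 + 1) + N (x0 + 1)) - (W x + N x)\<bar> \<le> \<kappa>'" if xT: "T \<le> x" "x \<le> x0 + 1" for x
    proof -
      define y where "y = max x r"
      have "\<bar>(W (x0 + 1) + N (x0 + 1)) - (W y + N y)\<bar>
          \<le> 2 * K * (x0 + 1 - y) - 0 * (w (x0 + 1) - w y)"
      proof (rule derivative_error_integrated[OF _ DN riccatiD(3)[OF R]])
        show "\<bar>w z + max 0 (- B z)\<bar> \<le> 2 * K - 0 * w' z" for z
          using wK[of z] K(2)[of z] by (simp add: abs_le_iff max_def)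
      qed (use xT \<rho> in \<open>auto simp: y_def r_def\<close>)
      also have "\<dots> \<le> 2 * K * \<rho>"
        using K(1) by (auto simp: y_def r_def)
      finally have 1: "\<bar>(W (x0 + 1) + N (x0 + 1)) - (W y + N y)\<bar> \<le> \<kappa>' / 2"
        using \<rho>(3) by linarith
      have "\<bar>(W y + N y) - (W x + N x)\<bar> \<le> q * (y - x) - k * (w y - w x)"
      proof (rule derivative_error_integrated[OF _ DN riccatiD(3)[OF R]])
        fix z assume z: "x < z" "z < y"
        then have z': "z \<in> {l..r}" "T < z" "z \<le> r" using xT T by (auto simp: y_def)
        \<comment> \<open>Changing the signs of both \<open>w\<close> and \<open>B\<close> preserves
          the residual and makes \<open>max 0 (- B)\<close> the larger root, so the same error bound
          serves to the right of \<open>T\<close>.\<close>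
        have "- w z \<ge> \<theta> z * - B z" using right[OF z'(2,3)] by simp
        moreover have "- w z * (- w z - - B z) \<le> \<eta>" using res[of z] by (simp add: algebra_simps)
        ultimately have "\<bar>- w z - max 0 (- B z)\<bar>
            \<le> \<tau> + (2 * max 0 \<eta> - - w z * (- w z - - B z)) / (\<sigma> * \<tau>)"
          using error_bound_from_residual[OF \<sigma> _ _ _ _ \<tau>] \<theta>[OF z'(1)] by blast
        also have "- w z * (- w z - - B z) = w z * (w z - B z)" by (simp add: algebra_simps)
        finally show "\<bar>w z + max 0 (- B z)\<bar> \<le> q - k * w' z"
          using residual_deriv[of z] by linarith
      qed (simp add: y_def)
      also have "\<dots> \<le> \<kappa>' / 2"
      proof -
        have "x \<ge> x0" "y \<le> x0 + 1" using xT T \<rho> by (auto simp: y_def l_def r_def)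
        then show ?thesis using wdiff[of y x] qlen[of x y] small by linarith
      qed
      finally show ?thesis using 1 by linarith
    qed
    have W1: "W (x0 + 1) = W x0" by (rule riccatiD(1)[OF R])
    have x': "x0 \<le> x" and x'': "x \<le> x0 + 1" using x by auto
    have T01: "x0 \<le> T" "T \<le> x0 + 1" using T \<rho> by (auto simp: l_def r_def)
    have monoP: "P y \<le> P z" if "y \<le> z" for y z
      by (rule DERIV_nonneg_imp_nondecreasing[OF that]) (use P in force)
    have monoN: "N y \<le> N z" if "y \<le> z" for y z
      by (rule DERIV_nonneg_imp_nondecreasing[OF that]) (use N in force)
    \<comment> \<open>Both profiles at \<open>T\<close>, together with
      \<open>W (x0 + 1) = W x0\<close>, show that \<open>P T - P x0\<close> and
      \<open>N (x0 + 1) - N T\<close> differ by at most \<open>2 * \<kappa>'\<close>. Monotonicity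
      of \<open>P\<close> and \<open>N\<close> then decides, up to this error, which term is the
      minimum on either side of \<open>T\<close>.\<close>
    show "\<bar>W x - W x0 - min (P x - P x0) (N (x0 + 1) - N x)\<bar> \<le> \<kappa>"
    proof (cases "x \<le> T")
      case True
      show ?thesis
        using leftP[OF x' True] leftP[OF T01(1) order_refl] rightN[OF order_refl T01(2)]
          monoP[OF True] monoN[OF True] W1 unfolding \<kappa>'_def by linarith
    next
      case False
      then have Tx: "T \<le> x" by simp
      show ?thesis
        using rightN[OF Tx x''] leftP[OF T01(1) order_refl] rightN[OF order_refl T01(2)]
          monoP[OF Tx] monoN[OF Tx] W1 unfolding \<kappa>'_def by linarith
    qed
  qed
qed

end

subsection \<open>The action functional\<close>

text \<open>An antiderivative of a periodic function need not be periodic, but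
  \<open>F (x + k) - F x\<close> has derivative zero. This moves estimates between different lifts
  of a point of the circle.\<close>

lemma antiderivative_shift:
  fixes F f :: "real \<Rightarrow> real"
  assumes F: "\<And>x. (F has_real_derivative f x) (at x)" and f: "\<And>x. f (x + 1) = f x"
  shows "F (x + of_int k) - F (y + of_int k) = F x - F y"
proof -
  interpret periodic_fun_simple' f by unfold_locales (rule f)
  have "((\<lambda>x. F (x + of_int k) - F x) has_real_derivative 0) (at x)" for x
  proof -
    have "((\<lambda>x. F (x + of_int k)) has_real_derivative f (x + of_int k)) (at x)"
      using F[of "x + of_int k"] DERIV_shift by blast
    from DERIV_diff[OF this F] show ?thesis by (simp add: plus_of_int)
  qed
  then have "F (x + of_int k) - F x = F (y + of_int k) - F y"
    by (intro DERIV_isconst_all) blast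
  then show ?thesis by simp
qed

text \<open>A slope of at least \<open>m > 0\<close> makes \<open>T\<close> unbounded in both
  directions, so the inverse is defined on the whole line.\<close>

lemma inverse_of_expanding_function:
  fixes T T' :: "real \<Rightarrow> real"
  assumes T: "\<And>x. (T has_real_derivative T' x) (at x)" and "m > 0" and T': "\<And>x. T' x \<ge> m"
  obtains g where "\<And>x. g (T x) = x" "\<And>s. (g has_real_derivative inverse (T' (g s))) (at s)"
proof -
  have expand: "T y - T x \<ge> m * (y - x)" if "x < y" for x y
  proof -
    obtain z where "T y - T x = (y - x) * T' z" using MVT2[OF \<open>x < y\<close>, of T T'] T by blast
    moreover have "(y - x) * T' z \<ge> (y - x) * m" using T' that by (intro mult_left_mono) auto
    ultimately show ?thesis by (simp add: mult.commute)
  qed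
  have less: "T x < T y" if "x < y" for x y
    using expand[OF that] mult_pos_pos[of m "y - x"] \<open>m > 0\<close> that by linarith
  then have inj: "inj T" by (metis injI linorder_neq_iff)
  have cont: "continuous_on UNIV T" by (rule DERIV_continuous_on[OF T])
  have "\<exists>x. T x = s" for s
  proof -
    define d where "d = \<bar>s - T 0\<bar> / m + 1"
    have d: "d > 0" "m * d \<ge> \<bar>s - T 0\<bar>" using \<open>m > 0\<close> by (auto simp: d_def distrib_left add_nonneg_pos)
    have "T (- d) \<le> s" "s \<le> T d" using expand[of 0 d] expand[of "- d" 0] d by auto
    moreover have "continuous_on {- d..d} T" by (rule continuous_on_subset[OF cont]) simp
    ultimately show ?thesis using IVT'[of T "- d" s d] d by auto
  qed
  then have surj: "surj T" by (metis surj_def)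
  define g where "g = inv T"
  have gT: "g (T x) = x" for x using inj by (simp add: g_def)
  have Tg: "T (g s) = s" for s using surj by (simp add: g_def surj_f_inv_f)
  have "continuous_on UNIV g"
  proof (rule continuous_onI_mono)
    have "range g = UNIV" using gT by (metis surj_def)
    then show "open (range g)" by simp
    show "g x \<le> g y" if "x \<le> y" for x y using less[of "g y" "g x"] Tg that by force
  qed
  then have gc: "isCont g s" for s by (simp add: continuous_on_eq_continuous_at)
  have "(g has_real_derivative inverse (T' (g s))) (at s)" for s
  proof (rule DERIV_inverse_function[where a = "s - 1" and b = "s + 1"])
    show "T' (g s) \<noteq> 0" using T'[of "g s"] \<open>m > 0\<close> by linarith
  qed (use T Tg gc in auto)
  then show thesis using that gT by blast
qed

context circle_operator
begin

abbreviation action :: "real \<Rightarrow> (real \<Rightarrow> real) \<Rightarrow> real" where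
  "action t \<eta> \<equiv> integral {0..t} (\<lambda>s. lagrangian a b (- deriv \<eta> s) (\<eta> s))"

lemma lagrangian_continuous:
  assumes "continuous_on S v" "continuous_on S \<eta>"
  shows "continuous_on S (\<lambda>s. lagrangian a b (v s) (\<eta> s))"
  unfolding lagrangian_def
  by (intro continuous_intros assms continuous_on_compose2[OF a_cont] continuous_on_compose2[OF b_cont])
    auto

text \<open>
  \<open>\<Gamma>\<close> is a subsolution of the Hamilton-Jacobi equation with \<open>L\<close> as Lagrangian, in the form given
  by the Fenchel inequality.
\<close>

lemma action_ge:
  assumes \<Gamma>: "\<And>y. (\<Gamma> has_real_derivative \<Gamma>' y) (at y)"
    and sub: "\<And>v y. v * \<Gamma>' y \<le> lagrangian a b (- v) y"
    and curve: "piecewise_C1_curve t \<eta>"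
  shows "\<Gamma> (\<eta> t) - \<Gamma> (\<eta> 0) \<le> action t \<eta>"
proof -
  let ?L = "\<lambda>s. lagrangian a b (- deriv \<eta> s) (\<eta> s)"
  obtain n p where p: "p 0 = 0" "p n = t" and pieces: "\<And>i. i < n \<Longrightarrow> p i < p (Suc i) \<and>
      (\<exists>D. continuous_on {p i..p (Suc i)} D \<and> (\<forall>s\<in>{p i..p (Suc i)}.
        (\<eta> has_real_derivative D s) (at s within {p i..p (Suc i)})))"
    using curve unfolding piecewise_C1_curve_def by auto
  \<comment> \<open>Integrability is carried along with the inequality, because the integral over
    \<open>{0..t}\<close> is assembled from the closed pieces.\<close>
  have "i \<le> n \<Longrightarrow> 0 \<le> p i \<and> (\<exists>I. (?L has_integral I) {0..p i} \<and> \<Gamma> (\<eta> (p i)) - \<Gamma> (\<eta> 0) \<le> I)" for i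
  proof (induction i)
    case 0
    then show ?case using p by (auto intro!: exI[of _ 0] simp: has_integral_refl)
  next
    case (Suc i)
    then obtain I where I: "0 \<le> p i" "(?L has_integral I) {0..p i}" "\<Gamma> (\<eta> (p i)) - \<Gamma> (\<eta> 0) \<le> I"
      by auto
    define l where "l = p i"
    define r where "r = p (Suc i)"
    obtain D where lr: "l < r" and D: "continuous_on {l..r} D"
      "\<And>s. s \<in> {l..r} \<Longrightarrow> (\<eta> has_real_derivative D s) (at s within {l..r})"
      using pieces[of i] Suc.prems by (auto simp: l_def r_def)
    have \<eta>: "continuous_on {l..r} \<eta>" by (rule DERIV_continuous_on[OF D(2)])
    have "continuous_on {l..r} (\<lambda>s. lagrangian a b (- D s) (\<eta> s))"
      by (intro lagrangian_continuous continuous_intros D(1) \<eta>)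
    then obtain J where J: "((\<lambda>s. lagrangian a b (- D s) (\<eta> s)) has_integral J) {l..r}"
      using integrable_continuous_real by blast
    have "((\<lambda>s. \<Gamma>' (\<eta> s) * D s) has_integral \<Gamma> (\<eta> r) - \<Gamma> (\<eta> l)) {l..r}"
    proof (rule fundamental_theorem_of_calculus)
      fix s assume s: "s \<in> {l..r}"
      have "((\<lambda>s. \<Gamma> (\<eta> s)) has_real_derivative \<Gamma>' (\<eta> s) * D s) (at s within {l..r})"
        by (rule DERIV_chain2[OF \<Gamma> D(2)[OF s]])
      then show "((\<lambda>s. \<Gamma> (\<eta> s)) has_vector_derivative \<Gamma>' (\<eta> s) * D s) (at s within {l..r})"
        by (simp add: has_real_derivative_iff_has_vector_derivative)
    qed (use lr in simp)
    then have "\<Gamma> (\<eta> r) - \<Gamma> (\<eta> l) \<le> J"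
      by (rule has_integral_le[OF _ J]) (use sub in \<open>simp add: mult.commute\<close>)
    \<comment> \<open>\<open>deriv \<eta>\<close> agrees with \<open>D\<close> in the interior of
      the piece; the two endpoints, where it may differ, are negligible.\<close>
    moreover have "(?L has_integral J) {l..r}"
    proof (rule has_integral_spike_finite[OF _ _ J, of "{l, r}"])
      fix s assume s: "s \<in> {l..r} - {l, r}"
      then have "(\<eta> has_real_derivative D s) (at s)"
        using D(2)[of s] at_within_Icc_at[of l s r] by auto
      then show "?L s = lagrangian a b (- D s) (\<eta> s)" by (simp add: DERIV_imp_deriv)
    qed simp
    then have "(?L has_integral (I + J)) {0..r}"
      using has_integral_combine[of 0 l r] I lr by (simp add: l_def)
    ultimately show ?case using I lr by (auto simp: l_def r_def intro!: exI[of _ "I + J"])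
  qed
  from this[of n] p show ?thesis by (auto dest: integral_unique)
qed

text \<open>Expanding \<open>(v + b)\<^sup>2 \<ge> 0\<close> bounds the Lagrangian below by
  \<open>- v * B\<close>, and it is nonnegative; each left-hand side is one of these two values. So
  antiderivatives of \<open>max 0 (- B)\<close> and \<open>- max 0 B\<close> are subsolutions,
  adapted to moving right and left.\<close>

lemma lagrangian_ge_right: "v * max 0 (- B y) \<le> lagrangian a b (- v) y"
  and lagrangian_ge_left: "v * - max 0 (B y) \<le> lagrangian a b (- v) y"
proof -
  have "- v * b y * 4 \<le> (- v + b y)\<^sup>2"
    using zero_le_power2[of "v + b y"] by (simp add: power2_eq_square algebra_simps)
  then have "- v * b y * 4 / (4 * a y) \<le> lagrangian a b (- v) y"
    unfolding lagrangian_def using a_pos[of y] by (intro divide_right_mono) auto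
  then have 1: "v * - B y \<le> lagrangian a b (- v) y" by (simp add: B_def)
  have 2: "0 \<le> lagrangian a b (- v) y"
    unfolding lagrangian_def using a_pos[of y] by simp
  show "v * max 0 (- B y) \<le> lagrangian a b (- v) y" "v * - max 0 (B y) \<le> lagrangian a b (- v) y"
    using 1 2 by (auto simp: max_def)
qed

text \<open>
  The curve moves in direction \<open>s\<close> with speed \<open>|b| + \<delta>\<close>; along or against the drift \<open>b\<close>, this is
  optimal up to the perturbation \<open>\<delta>\<close>, without which the curve would not pass the zeros of \<open>b\<close>.
\<close>

lemma efficient_curve:
  assumes s: "s = 1 \<or> s = -1" and sy: "s * (y - z) > 0" and "e > 0"
    and \<Phi>: "\<And>x. (\<Phi> has_real_derivative max 0 (- (s * B x))) (at x)"
  obtains t \<eta> where "t > 0" "piecewise_C1_curve t \<eta>" "\<eta> 0 = z" "\<eta> t = y"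
    "action t \<eta> \<le> s * (\<Phi> y - \<Phi> z) + e"
proof -
  have "continuous_on UNIV (\<lambda>x. 1 / a x)" by (intro continuous_intros a_cont) simp
  then obtain A where A: "\<And>x. (A has_real_derivative 1 / a x) (at x)"
    using antiderivative_exists by blast
  \<comment> \<open>The extra speed \<open>\<delta>\<close> costs at most
    \<open>\<delta> / (4 * a)\<close> per unit length beyond the optimum, hence at most
    \<open>\<delta> / 4 * k = e\<close> in total.\<close>
  define k where "k = \<bar>A y - A z\<bar> + 1"
  define \<delta> where "\<delta> = 4 * e / k"
  have k: "k > 0" by (simp add: k_def add_nonneg_pos)
  have \<delta>: "\<delta> > 0" using \<open>e > 0\<close> k by (simp add: \<delta>_def)
  obtain Kb where Kb: "\<And>x. \<bar>b x\<bar> \<le> Kb"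
    using periodic_bounded[OF b_periodic b_cont] by blast
  define S where "S x = \<bar>b x\<bar> + \<delta>" for x
  have S: "S x > 0" "S x \<le> Kb + \<delta>" for x using \<delta> Kb[of x] by (auto simp: S_def)
  have S_cont: "continuous_on UNIV S" unfolding S_def by (intro continuous_intros b_cont)
  have "continuous_on UNIV (\<lambda>x. 1 / S x)"
    using S(1) by (intro continuous_intros S_cont) (metis less_irrefl)
  \<comment> \<open>Up to a constant, \<open>T\<close> is the travel time at speed \<open>S\<close>;
    its inverse yields the trajectory, so no differential equation has to be solved.\<close>
  then obtain T where T: "\<And>x. (T has_real_derivative 1 / S x) (at x)"
    using antiderivative_exists by blast
  have "1 / S x \<ge> 1 / (Kb + \<delta>)" for x
    using S[of x] by (intro divide_left_mono mult_pos_pos) linarith+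
  moreover have "1 / (Kb + \<delta>) > 0" using S[of 0] by simp
  ultimately obtain g where gT: "\<And>x. g (T x) = x"
    and g': "\<And>x. (g has_real_derivative inverse (1 / S (g x))) (at x)"
    using inverse_of_expanding_function[OF T] by metis
  define \<eta> where "\<eta> x = g (T z + s * x)" for x
  define t where "t = s * (T y - T z)"
  have ss: "s * s = 1" using s by auto
  have \<eta>': "(\<eta> has_real_derivative s * S (\<eta> x)) (at x)" for x
  proof -
    have "((\<lambda>x. T z + s * x) has_real_derivative s) (at x)"
      by (auto intro!: derivative_eq_intros)
    then have "(\<eta> has_real_derivative inverse (1 / S (g (T z + s * x))) * s) (at x)"
      unfolding \<eta>_def by (rule DERIV_chain2[OF g'])
    then show ?thesis by (simp add: \<eta>_def mult.commute)
  qed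
  have \<eta>_cont: "continuous_on UNIV \<eta>" by (rule DERIV_continuous_on[OF \<eta>'])
  have S\<eta>_cont: "continuous_on X (\<lambda>x. s * S (\<eta> x))" for X
    by (intro continuous_intros continuous_on_compose2[OF S_cont] continuous_on_subset[OF \<eta>_cont]) auto
  have deriv: "deriv \<eta> x = s * S (\<eta> x)" for x by (rule DERIV_imp_deriv[OF \<eta>'])
  have T_less: "T x < T x'" if "x < x'" for x x'
    by (rule DERIV_pos_imp_increasing[OF that]) (use T S(1) in \<open>meson zero_less_divide_1_iff\<close>)
  have t: "t > 0"
    using s sy T_less[of y z] T_less[of z y] by (auto simp: t_def)
  have ends: "\<eta> 0 = z" "\<eta> t = y"
    using ss gT by (auto simp: \<eta>_def t_def simp flip: mult.assoc)
  have curve: "piecewise_C1_curve t \<eta>"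
    unfolding piecewise_C1_curve_def
  proof (intro exI conjI)
    show "(\<lambda>i::nat. if i = 0 then 0 else t) 0 = 0" "(\<lambda>i::nat. if i = 0 then 0 else t) 1 = t" by auto
    show "\<forall>i<1::nat. (if i = 0 then 0 else t) < (if Suc i = 0 then 0 else t) \<and>
      (\<exists>D. continuous_on {if i = 0 then 0 else t..if Suc i = 0 then 0 else t} D \<and>
        (\<forall>x\<in>{if i = 0 then 0 else t..if Suc i = 0 then 0 else t}. (\<eta> has_real_derivative D x)
           (at x within {if i = 0 then 0 else t..if Suc i = 0 then 0 else t})))"
      using t S\<eta>_cont has_field_derivative_at_within[OF \<eta>']
      by (auto intro!: exI[of _ "\<lambda>x. s * S (\<eta> x)"])
  qed
  define \<Psi> where "\<Psi> x = s * (\<Phi> (\<eta> x) + \<delta> / 4 * A (\<eta> x))" for x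
  have \<Psi>': "(\<Psi> has_real_derivative S (\<eta> x) * (max 0 (- (s * B (\<eta> x))) + \<delta> / (4 * a (\<eta> x)))) (at x)" for x
  proof -
    have "(\<Psi> has_real_derivative s * (max 0 (- (s * B (\<eta> x))) * (s * S (\<eta> x))
        + \<delta> / 4 * (1 / a (\<eta> x) * (s * S (\<eta> x))))) (at x)"
      unfolding \<Psi>_def
      by (intro DERIV_cmult DERIV_add DERIV_chain2[OF \<Phi> \<eta>'] DERIV_chain2[OF A \<eta>'])
    moreover have "s * (max 0 (- (s * B (\<eta> x))) * (s * S (\<eta> x)) + \<delta> / 4 * (1 / a (\<eta> x) * (s * S (\<eta> x))))
        = (s * s) * (S (\<eta> x) * (max 0 (- (s * B (\<eta> x))) + \<delta> / (4 * a (\<eta> x))))"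
      by (simp add: algebra_simps)
    ultimately show ?thesis unfolding ss mult_1 by metis
  qed
  have speed: "lagrangian a b (- (s * S x)) x \<le> S x * (max 0 (- (s * B x)) + \<delta> / (4 * a x))" for x
  proof -
    have "(- (s * S x) + b x)\<^sup>2 \<le> S x * (4 * max 0 (- (s * b x)) + \<delta>)"
    proof -
      \<comment> \<open>Here \<open>\<beta> = s * b\<close>. Moving with the drift leaves
        \<open>\<delta>\<^sup>2\<close> on the left, moving against it
        \<open>(2 * \<bar>\<beta>\<bar> + \<delta>)\<^sup>2\<close>.\<close>
      have *: "(\<bar>\<beta>\<bar> + \<delta> - \<beta>)\<^sup>2 \<le> (\<bar>\<beta>\<bar> + \<delta>) * (4 * max 0 (- \<beta>) + \<delta>)" for \<beta> :: real
      proof (cases "\<beta> \<ge> 0")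
        case True
        then show ?thesis using \<delta> by (simp add: power2_eq_square algebra_simps max_def)
      next
        case False
        then have "\<beta> * \<delta> \<le> 0" using \<delta> by (simp add: mult_nonpos_nonneg)
        then show ?thesis using False by (simp add: power2_eq_square algebra_simps max_def)
      qed
      have "(- (s * S x) + b x)\<^sup>2 = (\<bar>s * b x\<bar> + \<delta> - s * b x)\<^sup>2"
        using s by (auto simp: S_def power2_eq_square algebra_simps)
      also have "\<dots> \<le> S x * (4 * max 0 (- (s * b x)) + \<delta>)"
        using *[of "s * b x"] s by (auto simp: S_def)
      finally show ?thesis .
    qed
    then have "lagrangian a b (- (s * S x)) x \<le> S x * (4 * max 0 (- (s * b x)) + \<delta>) / (4 * a x)"
      unfolding lagrangian_def using a_pos[of x] by (intro divide_right_mono) auto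
    also have "\<dots> = S x * (max 0 (- (s * b x)) / a x + \<delta> / (4 * a x))"
      by (simp add: field_simps)
    also have "max 0 (- (s * b x)) / a x = max 0 (- (s * B x))"
      using a_pos[of x] by (auto simp: B_def max_def divide_le_0_iff zero_le_divide_iff zero_le_mult_iff mult_le_0_iff)
    finally show ?thesis .
  qed
  have int\<Psi>: "((\<lambda>x. S (\<eta> x) * (max 0 (- (s * B (\<eta> x))) + \<delta> / (4 * a (\<eta> x))))
      has_integral \<Psi> t - \<Psi> 0) {0..t}"
    by (rule fundamental_theorem_of_calculus)
      (use t \<Psi>' in \<open>auto simp: has_real_derivative_iff_has_vector_derivative[symmetric]
        intro: has_field_derivative_at_within\<close>)
  have "continuous_on {0..t} (\<lambda>x. lagrangian a b (- (s * S (\<eta> x))) (\<eta> x))"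
    by (intro lagrangian_continuous continuous_intros S\<eta>_cont continuous_on_subset[OF \<eta>_cont]) auto
  then have "action t \<eta> \<le> \<Psi> t - \<Psi> 0"
    unfolding deriv
    by (intro has_integral_le[OF integrable_integral[OF integrable_continuous_real] int\<Psi>] speed)
  also have "\<Psi> t - \<Psi> 0 = s * (\<Phi> y - \<Phi> z) + \<delta> / 4 * (s * (A y - A z))"
    by (simp add: \<Psi>_def ends algebra_simps)
  also have "\<dots> \<le> s * (\<Phi> y - \<Phi> z) + \<delta> / 4 * k"
    using s \<delta> by (intro add_left_mono mult_left_mono) (auto simp: k_def)
  also have "\<delta> / 4 * k = e" using k by (simp add: \<delta>_def)
  finally show thesis using that t curve ends by blast
qed

text \<open>A lift from \<open>z + i\<close> to \<open>x0 + j\<close> ends either at or left of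
  \<open>x0 + i\<close>, or at or right of \<open>x0 + 1 + i\<close>. The two subsolutions and their
  monotonicity bound its action by the leftward or the rightward value, and further winding does not
  lower it. Efficient curves in both directions come arbitrarily close to these values.\<close>

lemma mane_potential_eq:
  assumes P: "\<And>x. (P has_real_derivative max 0 (B x)) (at x)"
    and N: "\<And>x. (N has_real_derivative max 0 (- B x)) (at x)"
    and "b x0 = 0" and z: "x0 \<le> z" "z < x0 + 1"
  shows "mane_potential a b z x0 = min (P z - P x0) (N (x0 + 1) - N z)"
proof -
  define X where "X = {action t \<eta> | t \<eta>. t > 0 \<and> \<eta> \<in> circle_curves z x0 t}"
  have monoP: "P y \<le> P z" if "y \<le> z" for y z
    by (rule DERIV_nonneg_imp_nondecreasing[OF that]) (use P in force)
  have monoN: "N y \<le> N z" if "y \<le> z" for y z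
    by (rule DERIV_nonneg_imp_nondecreasing[OF that]) (use N in force)
  have lower: "min (P z - P x0) (N (x0 + 1) - N z) \<le> v" if "v \<in> X" for v
  proof -
    obtain t \<eta> where v: "v = action t \<eta>" and \<eta>: "piecewise_C1_curve t \<eta>" "\<eta> 0 - z \<in> \<int>" "\<eta> t - x0 \<in> \<int>"
      using \<open>v \<in> X\<close> by (auto simp: X_def circle_curves_def)
    obtain i where i: "\<eta> 0 = z + of_int i" using \<eta>(2) by (metis Ints_cases add.commute diff_add_cancel)
    obtain j where j: "\<eta> t = x0 + of_int j" using \<eta>(3) by (metis Ints_cases add.commute diff_add_cancel)
    have Nv: "N (\<eta> t) - N (\<eta> 0) \<le> v"
      unfolding v by (rule action_ge[OF N lagrangian_ge_right \<eta>(1)])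
    have Pv: "- P (\<eta> t) - - P (\<eta> 0) \<le> v"
      unfolding v by (rule action_ge[OF DERIV_minus[OF P] lagrangian_ge_left \<eta>(1)])
    show ?thesis
    proof (cases "j \<le> i")
      case True
      have "P (\<eta> t) \<le> P (x0 + of_int i)" using True by (intro monoP) (simp add: j)
      moreover have "P (z + of_int i) - P (x0 + of_int i) = P z - P x0"
        by (rule antiderivative_shift[OF P]) (simp add: B_periodic)
      ultimately show ?thesis using Pv i by simp
    next
      case False
      have "N (x0 + 1 + of_int i) \<le> N (\<eta> t)" using False by (intro monoN) (simp add: j)
      moreover have "N (x0 + 1 + of_int i) - N (z + of_int i) = N (x0 + 1) - N z"
        by (rule antiderivative_shift[OF N]) (simp add: B_periodic)
      ultimately show ?thesis using Nv i by simp
    qed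
  qed
  have upper: "\<exists>v\<in>X. v \<le> min (P z - P x0) (N (x0 + 1) - N z) + e" if "e > 0" for e
  proof (cases "z = x0")
    case True
    \<comment> \<open>\<open>efficient_curve\<close> needs distinct endpoints; for
      \<open>z = x0\<close> the constant curve is used, which costs nothing at a zero of
      \<open>b\<close>.\<close>
    have "piecewise_C1_curve 1 (\<lambda>_. x0)"
      unfolding piecewise_C1_curve_def
      by (rule exI[of _ 1], rule exI[of _ real]) (auto intro!: exI[of _ "\<lambda>_. 0"] derivative_eq_intros)
    then have "action 1 (\<lambda>_. x0) \<in> X" unfolding X_def using True
      by (auto simp: circle_curves_def intro!: exI[of _ "1::real"] exI[of _ "\<lambda>_. x0"])
    moreover have "action 1 (\<lambda>_. x0) = 0"
      using \<open>b x0 = 0\<close> by (simp add: lagrangian_def)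
    moreover have "min (P z - P x0) (N (x0 + 1) - N z) \<ge> 0"
      using True monoN[of x0 "x0 + 1"] by simp
    ultimately show ?thesis using \<open>e > 0\<close>
      by (intro bexI[of _ "action 1 (\<lambda>_. x0)"]) linarith+
  next
    case False
    obtain t \<eta> where 1: "t > 0" "piecewise_C1_curve t \<eta>" "\<eta> 0 = z" "\<eta> t = x0 + 1"
      "action t \<eta> \<le> 1 * (N (x0 + 1) - N z) + e"
      by (rule efficient_curve[of 1 "x0 + 1" z e N]) (use z \<open>e > 0\<close> N in auto)
    obtain t' \<eta>' where 2: "t' > 0" "piecewise_C1_curve t' \<eta>'" "\<eta>' 0 = z" "\<eta>' t' = x0"
      "action t' \<eta>' \<le> (-1) * (P x0 - P z) + e"
      by (rule efficient_curve[of "-1" x0 z e P]) (use z False \<open>e > 0\<close> P in auto)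
    have "\<eta> \<in> circle_curves z x0 t" "\<eta>' \<in> circle_curves z x0 t'"
      using 1 2 by (auto simp: circle_curves_def)
    then have "action t \<eta> \<in> X" "action t' \<eta>' \<in> X"
      using 1(1) 2(1) unfolding X_def by blast+
    then show ?thesis using 1(5) 2(5) by (cases "P z - P x0 \<le> N (x0 + 1) - N z") force+
  qed
  have "X \<noteq> {}" using upper[of 1] by auto
  have "bdd_below X" using lower by (rule bdd_belowI)
  have "Inf X = min (P z - P x0) (N (x0 + 1) - N z)"
  proof (rule antisym)
    show "Inf X \<le> min (P z - P x0) (N (x0 + 1) - N z)"
    proof (rule field_le_epsilon)
      fix e :: real assume "e > 0"
      then obtain v where "v \<in> X" "v \<le> min (P z - P x0) (N (x0 + 1) - N z) + e" using upper by blast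
      then show "Inf X \<le> min (P z - P x0) (N (x0 + 1) - N z) + e"
        using cInf_lower[OF _ \<open>bdd_below X\<close>] by (meson order_trans)
    qed
    show "min (P z - P x0) (N (x0 + 1) - N z) \<le> Inf X"
      using \<open>X \<noteq> {}\<close> lower by (rule cInf_greatest)
  qed
  then show ?thesis by (simp add: mane_potential_def X_def)
qed

text \<open>The substitution is \<open>w = - \<epsilon> * u' / u\<close>. The eigenvalue is complex
  a priori; as \<open>u\<close> is real, taking real parts of the equation leaves
  \<open>Re \<mu>\<close>.\<close>

lemma riccati_of_eigenfunction:
  assumes "\<epsilon> > 0" and u: "\<And>x. u x > 0"
    and eig: "eigenpair a b c \<epsilon> \<mu> (\<lambda>x. complex_of_real (u x))"
  shows "\<exists>w w'. riccati \<epsilon> (Re \<mu>) (\<lambda>x. - \<epsilon> * ln (u x)) w w'"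
proof -
  obtain v v' where per: "periodic_fun_simple' (\<lambda>x. complex_of_real (u x))"
    and v: "\<And>x. ((\<lambda>x. complex_of_real (u x)) has_vector_derivative v x) (at x)"
    and v': "\<And>x. (v has_vector_derivative v' x) (at x)"
    and eq: "\<And>x. of_real (\<epsilon> * a x) * v' x + of_real (b x) * v x + of_real (c x) * of_real (u x)
      = \<mu> * of_real (u x)"
    using eig unfolding eigenpair_def by auto
  have u_per: "u (x + 1) = u x" for x
    using per by (simp add: periodic_fun_simple'_def)
  have u1: "(u has_real_derivative Re (v x)) (at x)" for x
    using bounded_linear.has_vector_derivative[OF bounded_linear_Re v[of x]]
    by (simp add: has_real_derivative_iff_has_vector_derivative)
  have u2: "((\<lambda>x. Re (v x)) has_real_derivative Re (v' x)) (at x)" for x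
    using bounded_linear.has_vector_derivative[OF bounded_linear_Re v'[of x]]
    by (simp add: has_real_derivative_iff_has_vector_derivative)
  have ode: "\<epsilon> * a x * Re (v' x) + b x * Re (v x) + c x * u x = Re \<mu> * u x" for x
    using arg_cong[OF eq[of x], of Re] by simp
  have u0 [simp]: "u x \<noteq> 0" for x using u[of x] by simp
  define w where "w x = - \<epsilon> * (Re (v x) / u x)" for x
  define w' where "w' x = - \<epsilon> * ((Re (v' x) * u x - Re (v x) * Re (v x)) / (u x * u x))" for x
  have "riccati \<epsilon> (Re \<mu>) (\<lambda>x. - \<epsilon> * ln (u x)) w w'"
    unfolding riccati_def
  proof (intro conjI allI)
    fix x
    show "- \<epsilon> * ln (u (x + 1)) = - \<epsilon> * ln (u x)" by (simp add: u_per)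
    show "((\<lambda>x. - \<epsilon> * ln (u x)) has_real_derivative w x) (at x)"
      unfolding w_def using u[of x] by (auto intro!: derivative_eq_intros u1)
    show "(w has_real_derivative w' x) (at x)"
      unfolding w_def w'_def by (intro DERIV_cmult DERIV_divide u1 u2 u0)
    have "\<epsilon> * (Re (v' x) / u x) = - B x * (Re (v x) / u x) - (c x - Re \<mu>) / a x"
    proof -
      have "\<epsilon> * a x * Re (v' x) = - b x * Re (v x) - (c x - Re \<mu>) * u x"
        using ode[of x] by (simp add: algebra_simps)
      then have "\<epsilon> * a x * Re (v' x) / (a x * u x)
          = (- b x * Re (v x) - (c x - Re \<mu>) * u x) / (a x * u x)" by simp
      then show ?thesis by (simp add: B_def diff_divide_distrib)
    qed
    then have "\<epsilon> * (\<epsilon> * (Re (v' x) / u x))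
        = \<epsilon> * (- B x * (Re (v x) / u x) - (c x - Re \<mu>) / a x)" by simp
    moreover have "\<epsilon> * w' x = - (\<epsilon> * (\<epsilon> * (Re (v' x) / u x))) + w x * w x"
      by (simp add: w_def w'_def diff_divide_distrib algebra_simps)
    ultimately show "\<epsilon> * w' x = w x * (w x - B x) + \<epsilon> * ((c x - Re \<mu>) / a x)"
      by (simp add: w_def algebra_simps)
  qed
  then show ?thesis by blast
qed

end

subsection \<open>Convergence to the potential\<close>

lemma Ck_circleD:
  assumes "Ck_circle k f"
  shows "f (x + 1) = f x" "0 < k \<Longrightarrow> (f has_real_derivative deriv f x) (at x)"
    "0 < k \<Longrightarrow> continuous_on UNIV (deriv f)" "continuous_on UNIV f"
proof -
  have per: "periodic_fun_simple' f" and diff: "\<And>j x. j < k \<Longrightarrow> (deriv ^^ j) f differentiable (at x)"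
    and cont: "continuous_on UNIV ((deriv ^^ k) f)"
    using assms by (auto simp: Ck_circle_def Ck_on_def)
  show "f (x + 1) = f x" using per by (simp add: periodic_fun_simple'_def)
  have jcont: "continuous_on UNIV ((deriv ^^ j) f)" if "j < k" for j
    using diff[OF that]
    by (simp add: continuous_on_eq_continuous_at differentiable_imp_continuous_within)
  then have jcont': "continuous_on UNIV ((deriv ^^ j) f)" if "j \<le> k" for j
    using cont that by (cases "j = k") auto
  show "(f has_real_derivative deriv f x) (at x)" if "0 < k"
    using diff[OF that, of x] by (simp add: DERIV_deriv_iff_real_differentiable)
  show "continuous_on UNIV (deriv f)" if "0 < k" using jcont'[of 1] that by simp
  show "continuous_on UNIV f" using jcont'[of 0] by simp
qed

lemma mane_potential_periodic:
  "mane_potential a b (z + of_int k) x = mane_potential a b z x"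
proof -
  have "\<eta> 0 - (z + of_int k) \<in> \<int> \<longleftrightarrow> \<eta> 0 - z \<in> \<int>" for \<eta> :: "real \<Rightarrow> real"
    by (metis Ints_add Ints_diff Ints_of_int add_diff_cancel diff_diff_eq diff_add_cancel)
  then show ?thesis by (simp add: mane_potential_def circle_curves_def)
qed

theorem corollary4p19:
  fixes a b c :: "real \<Rightarrow> real" and u :: "real \<Rightarrow> real \<Rightarrow> real" and x0 :: real
  assumes "Ck_circle 2 a" and "\<And>x. a x > 0"
    and "Ck_circle 1 b" and "Ck_circle 0 c"
    and "\<exists>x. b x > 0" and "\<exists>x. b x < 0"
    and "finite {x \<in> {0..<1}. b x = 0}"
    and "\<And>x. b x = 0 \<Longrightarrow> (\<exists>m\<ge>1. zero_of_order b x m) \<or> flat_zero b x"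
    and "\<And>\<epsilon> x. \<epsilon> > 0 \<Longrightarrow> u \<epsilon> x > 0"
    and "\<And>\<epsilon>. \<epsilon> > 0 \<Longrightarrow> principal_eigenfunction a b c \<epsilon> (\<lambda>x. complex_of_real (u \<epsilon> x))"
    and "b x0 = 0"
    and "\<And>x. b x = 0 \<Longrightarrow> - max 0 (deriv b x) + c x \<le> - max 0 (deriv b x0) + c x0"
    and "\<And>x. b x = 0 \<Longrightarrow> - max 0 (deriv b x) + c x = - max 0 (deriv b x0) + c x0
                \<Longrightarrow> x - x0 \<in> \<int>"
  shows "\<exists>C :: real \<Rightarrow> real.
           uniform_limit UNIV (\<lambda>\<epsilon> x. - \<epsilon> * ln (u \<epsilon> x) + C \<epsilon>)
             (\<lambda>x. mane_potential a b x x0) (at_right 0)"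
proof -
  interpret circle_operator a "deriv a" b "deriv b" c
    using Ck_circleD[OF assms(1)] Ck_circleD[OF assms(3)] Ck_circleD[OF assms(4)] assms(2)
    by unfold_locales auto
  have "continuous_on UNIV (\<lambda>x. max 0 (B x))" "continuous_on UNIV (\<lambda>x. max 0 (- B x))"
    by (intro continuous_intros B_cont)+
  then obtain P N where P: "\<And>x. (P has_real_derivative max 0 (B x)) (at x)"
    and N: "\<And>x. (N has_real_derivative max 0 (- B x)) (at x)"
    using antiderivative_exists by metis
  \<comment> \<open>No point strictly between \<open>x0\<close> and \<open>x0 + 1\<close> represents
    \<open>x0\<close> on the circle, so uniqueness of the maximum makes the inequality
    strict.\<close>
  have maximal: "c x - max 0 (deriv b x) < c x0 - max 0 (deriv b x0)"
    if x: "x0 < x" "x < x0 + 1" "b x = 0" for x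
  proof (rule ccontr)
    assume "\<not> c x - max 0 (deriv b x) < c x0 - max 0 (deriv b x0)"
    then have "x - x0 \<in> \<int>" using assms(12,13)[OF x(3)] by linarith
    then obtain k where "x - x0 = of_int k" by (rule Ints_cases)
    then have "0 < real_of_int k" "real_of_int k < 1" using x by linarith+
    then show False by simp
  qed
  \<comment> \<open>The constants normalise \<open>W\<close> to vanish at \<open>x0\<close>, as the
    potential does.\<close>
  have "uniform_limit UNIV (\<lambda>\<epsilon> x. - \<epsilon> * ln (u \<epsilon> x) + \<epsilon> * ln (u \<epsilon> x0))
      (\<lambda>x. mane_potential a b x x0) (at_right 0)"
  proof (rule uniform_limitI)
    fix e :: real assume "e > 0"
    then obtain \<epsilon>0 where "\<epsilon>0 > 0" and conv: "\<And>\<epsilon> \<mu> W w w' x. 0 < \<epsilon> \<Longrightarrow> \<epsilon> < \<epsilon>0 \<Longrightarrow>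
        riccati \<epsilon> \<mu> W w w' \<Longrightarrow> x \<in> {x0..x0 + 1} \<Longrightarrow>
        \<bar>W x - W x0 - min (P x - P x0) (N (x0 + 1) - N x)\<bar> \<le> e / 2"
      using riccati_convergence[OF P N \<open>b x0 = 0\<close> maximal, of "e / 2"] by (metis half_gt_zero)
    have "\<forall>x\<in>UNIV. dist (- \<epsilon> * ln (u \<epsilon> x) + \<epsilon> * ln (u \<epsilon> x0)) (mane_potential a b x x0) < e"
      if \<epsilon>: "0 < \<epsilon>" "\<epsilon> < \<epsilon>0" for \<epsilon>
    proof
      fix x
      \<comment> \<open>Both sides are 1-periodic in \<open>x\<close>, so they are compared at the
        representative of \<open>x\<close> in \<open>[x0, x0 + 1)\<close>.\<close>
      define z where "z = x0 + frac (x - x0)"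
      have xz: "x = z + of_int \<lfloor>x - x0\<rfloor>" by (simp add: z_def frac_def)
      have z: "x0 \<le> z" "z < x0 + 1" by (auto simp: z_def frac_lt_1)
      obtain \<mu> where "eigenpair a b c \<epsilon> \<mu> (\<lambda>x. complex_of_real (u \<epsilon> x))"
        using assms(10)[OF \<epsilon>(1)] by (auto simp: principal_eigenfunction_def)
      then obtain w w' where R: "riccati \<epsilon> (Re \<mu>) (\<lambda>x. - \<epsilon> * ln (u \<epsilon> x)) w w'"
        using riccati_of_eigenfunction[of \<epsilon> "u \<epsilon>"] \<epsilon>(1) assms(9) by blast
      interpret W: periodic_fun_simple' "\<lambda>x. - \<epsilon> * ln (u \<epsilon> x)"
        by unfold_locales (rule riccatiD(1)[OF R])
      have "- \<epsilon> * ln (u \<epsilon> x) = - \<epsilon> * ln (u \<epsilon> z)"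
        using W.plus_of_int[of z "\<lfloor>x - x0\<rfloor>"] by (simp flip: xz)
      moreover have "mane_potential a b x x0 = min (P z - P x0) (N (x0 + 1) - N z)"
        using mane_potential_periodic[of a b z "\<lfloor>x - x0\<rfloor>" x0] mane_potential_eq[OF P N \<open>b x0 = 0\<close> z]
        by (simp flip: xz)
      moreover have "\<bar>- \<epsilon> * ln (u \<epsilon> z) - - \<epsilon> * ln (u \<epsilon> x0) - min (P z - P x0) (N (x0 + 1) - N z)\<bar> \<le> e / 2"
        using conv[OF \<epsilon> R] z by simp
      ultimately show "dist (- \<epsilon> * ln (u \<epsilon> x) + \<epsilon> * ln (u \<epsilon> x0)) (mane_potential a b x x0) < e"
        using \<open>e > 0\<close> unfolding dist_real_def by linarith
    qed
    then show "\<forall>\<^sub>F \<epsilon> in at_right 0. \<forall>x\<in>UNIV.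
        dist (- \<epsilon> * ln (u \<epsilon> x) + \<epsilon> * ln (u \<epsilon> x0)) (mane_potential a b x x0) < e"
      using \<open>\<epsilon>0 > 0\<close> by (auto simp: eventually_at_right_field)
  qed
  then show ?thesis by (rule exI[of _ "\<lambda>\<epsilon>. \<epsilon> * ln (u \<epsilon> x0)"])
qed

end
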